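(* Let $G$ be a forest with $n = |V(G)|$ vertices. Then for every positive integer $r \geq n - 5$, the $r$-independence complex $\mathrm{Ind}_r(G)$ is shellable.
   Context: For a graph $G$ and integer $r \geq 1$, a subset $A \subseteq V(G)$ is $r$-independent if every connected component of the induced subgraph $G[A]$ has at most $r$ vertices. The $r$-independence complex $\mathrm{Ind}_r(G)$ is the simplicial complex on $V(G)$ whose faces are the $r$-independent subsets of $V(G)$. A (not necessarily pure) simplicial complex $\Delta$ is shellable if its facets can be ordered $F_1, \dots, F_t$ so that for each $k > 1$ the complex $\langle F_k \rangle \cap \langle F_1, \dots, F_{k-1}\rangle$ is pure of dimension $\dim F_k - 1$, where $\langle \mathcal{F}\rangle$ denotes the simplicial complex generated by the sets in $\mathcal{F}$. *)

theory Defs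
  imports "Graph_Theory.Graph_Theory"
begin

text \<open>
  Finite simple graphs are the locale \<^locale>\<open>graph\<close>: finite loop-free digraphs without parallel
  arcs whose arc relation is symmetric. The library predicate \<^const>\<open>forest\<close> counts the closed
  walk u, v, u along an edge as a cycle, so no graph with an edge satisfies it. A cycle in
  the undirected sense is a \<^const>\<open>pre_digraph.cycle\<close> with at least three arcs.
\<close>

definition forest_graph :: "('a, 'b) pre_digraph \<Rightarrow> bool" where
  "forest_graph G \<longleftrightarrow> graph G \<and> \<not> (\<exists>p. pre_digraph.cycle G p \<and> 3 \<le> length p)"

text \<open>
  The strongly connected components of a symmetric digraph are the connected components of the
  underlying undirected graph.
\<close>

definition r_independent :: "('a, 'b) pre_digraph \<Rightarrow> nat \<Rightarrow> 'a set \<Rightarrow> bool" where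
  "r_independent G r A \<longleftrightarrow>
     A \<subseteq> verts G \<and> (\<forall>C \<in> pre_digraph.sccs_verts (G \<restriction> A). card C \<le> r)"

definition Ind :: "nat \<Rightarrow> ('a, 'b) pre_digraph \<Rightarrow> 'a set set" where
  "Ind r G = {A. r_independent G r A}"

text \<open>
  A finite abstract simplicial complex is represented by the set of its faces. The empty face has
  dimension -1, hence the integer-valued dimension.
\<close>

definition abstract_complex :: "'a set set \<Rightarrow> bool" where
  "abstract_complex K \<longleftrightarrow> finite (\<Union>K) \<and> (\<forall>\<sigma>\<in>K. \<forall>\<tau>. \<tau> \<subseteq> \<sigma> \<longrightarrow> \<tau> \<in> K)"

definition facets :: "'a set set \<Rightarrow> 'a set set" where
  "facets K = {F \<in> K. \<forall>F'\<in>K. F \<subseteq> F' \<longrightarrow> F' = F}"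

definition face_dim :: "'a set \<Rightarrow> int" where
  "face_dim F = int (card F) - 1"

definition generated_complex :: "'a set set \<Rightarrow> 'a set set" where
  "generated_complex \<F> = {\<sigma>. \<exists>F\<in>\<F>. \<sigma> \<subseteq> F}"

definition pure_of_dim :: "'a set set \<Rightarrow> int \<Rightarrow> bool" where
  "pure_of_dim K d \<longleftrightarrow> K \<noteq> {} \<and> (\<forall>F\<in>facets K. face_dim F = d)"

text \<open>Positions in a list start at 0, so the condition below concerns all facets but the first.\<close>

definition shellable :: "'a set set \<Rightarrow> bool" where
  "shellable K \<longleftrightarrow> abstract_complex K \<and>
     (\<exists>Fs. distinct Fs \<and> set Fs = facets K \<and>
        (\<forall>k. 0 < k \<and> k < length Fs \<longrightarrow>
           pure_of_dim (generated_complex {Fs ! k} \<inter> generated_complex (set (take k Fs)))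
             (face_dim (Fs ! k) - 1)))"

end

theory Submission
  imports Defs
begin

text \<open>
  Call a connected set big if it has more than \<open>r\<close> vertices. Among the big sets joined to the rest
  of the forest by at most one edge \<open>uz\<close>, take a minimal one \<open>D\<close>, with \<open>u\<close> in \<open>D\<close>. By minimality
  every big set contains \<open>u\<close> or avoids \<open>D\<close>, so each facet of the deletion of \<open>u\<close> contains
  \<open>D - {u}\<close>, and \<open>u\<close> is a shedding vertex. The deletion is handled by induction. If \<open>r = 1\<close>, the
  link of \<open>u\<close> is the complex of the forest without the closed neighbourhood of \<open>u\<close>. If \<open>r \<ge> 2\<close>,
  at most four vertices lie outside \<open>D\<close>; then the big sets all meet \<open>{u}\<close> or \<open>{u, z}\<close>, up to one
  further component, or the forest is one exceptional tree with seven vertices. A set contains no big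
  set meeting a clique \<open>K\<close> iff removing its complement cuts off enough vertices from \<open>K\<close>. The
  branches cut off by single vertices form a laminar family, and the sets whose complement indexes
  members of a laminar family with a large union form a shellable complex.
\<close>

section \<open>Shellings and shedding vertices\<close>

text \<open>\<^term>\<open>E\<close> ranges over the facets preceding \<^term>\<open>F\<close>: the intersection of \<^term>\<open>E\<close> and
  \<^term>\<open>F\<close> lies in the ridge \<^term>\<open>F - {x}\<close>, which some preceding facet contains.\<close>

primrec shelling_from :: "'a set set \<Rightarrow> 'a set list \<Rightarrow> bool" where
  "shelling_from P [] \<longleftrightarrow> True"
| "shelling_from P (F # Fs) \<longleftrightarrow>
     (\<forall>E\<in>P. \<exists>F'\<in>P. \<exists>x\<in>F - E. F - {x} \<subseteq> F') \<and> shelling_from (insert F P) Fs"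

lemma shelling_from_append:
  "shelling_from P (xs @ ys) \<longleftrightarrow> shelling_from P xs \<and> shelling_from (P \<union> set xs) ys"
  by (induction xs arbitrary: P) auto

lemma shelling_from_nth:
  assumes "shelling_from P Fs" "k < length Fs" "E \<in> P \<union> set (take k Fs)"
  shows "\<exists>F'\<in>P \<union> set (take k Fs). \<exists>x\<in>Fs ! k - E. Fs ! k - {x} \<subseteq> F'"
proof -
  have "Fs = take k Fs @ Fs ! k # drop (Suc k) Fs"
    using assms(2) by (rule id_take_nth_drop)
  then have "shelling_from P (take k Fs @ Fs ! k # drop (Suc k) Fs)"
    using assms(1) by simp
  then show ?thesis
    using assms(3) unfolding shelling_from_append shelling_from.simps by blast
qed

text \<open>This appends the facets through \<open>x\<close>. Against an earlier \<open>E\<close>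
  without \<open>x\<close>, the ridge omits \<open>x\<close> and lies in a member of
  \<open>P\<close>; against \<open>insert x E0\<close> it is a ridge of the shelling
  \<open>Fs\<close> with \<open>x\<close> added.\<close>

lemma shelling_from_map_insert:
  assumes "shelling_from Q Fs" "\<And>E. E \<in> P \<Longrightarrow> x \<notin> E" "\<And>F. F \<in> Q \<union> set Fs \<Longrightarrow> x \<notin> F"
    and "\<And>F. F \<in> set Fs \<Longrightarrow> \<exists>F'\<in>P. F \<subseteq> F'"
  shows "shelling_from (P \<union> insert x ` Q) (map (insert x) Fs)"
  using assms
proof (induction Fs arbitrary: Q)
  case (Cons F Fs)
  have "\<exists>F'\<in>P \<union> insert x ` Q. \<exists>y\<in>insert x F - E. insert x F - {y} \<subseteq> F'"
    if "E \<in> P \<union> insert x ` Q" for E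
    using that
  proof
    assume "E \<in> P"
    moreover obtain F' where "F' \<in> P" "F \<subseteq> F'" using Cons.prems(4) by auto
    ultimately show ?thesis using Cons.prems(2) by (intro bexI[of _ F'] bexI[of _ x]) auto
  next
    assume "E \<in> insert x ` Q"
    then obtain E0 where E0: "E0 \<in> Q" "E = insert x E0" by auto
    then obtain F' y where F': "F' \<in> Q" "y \<in> F - E0" "F - {y} \<subseteq> F'"
      using Cons.prems(1) by auto
    then have "y \<noteq> x" using Cons.prems(3) by auto
    then show ?thesis using F' E0 by (intro bexI[of _ "insert x F'"] bexI[of _ y]) auto
  qed
  moreover have "shelling_from (P \<union> insert x ` insert F Q) (map (insert x) Fs)"
  proof (rule Cons.IH)
    show "shelling_from (insert F Q) Fs" using Cons.prems(1) by simp
    show "\<exists>F'\<in>P. F \<subseteq> F'" if "F \<in> set Fs" for F using that Cons.prems(4) by simp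
  qed (use Cons.prems(2,3) in auto)
  ultimately show ?case by simp
qed simp

text \<open>Shellability in exchange form. Dimensions do not occur in it, which makes shellings easy
  to concatenate.\<close>

definition comb_shellable :: "'a set set \<Rightarrow> bool" where
  "comb_shellable K \<longleftrightarrow> abstract_complex K \<and>
     (\<exists>Fs. distinct Fs \<and> set Fs = facets K \<and> shelling_from {} Fs)"

lemma finite_face: "abstract_complex K \<Longrightarrow> F \<in> K \<Longrightarrow> finite F"
  unfolding abstract_complex_def by (meson Union_upper finite_subset)

lemma face_subset_facet:
  assumes "abstract_complex K" "A \<in> K"
  shows "\<exists>F\<in>facets K. A \<subseteq> F"
proof -
  have "finite K"
    using assms(1) finite_UnionD unfolding abstract_complex_def by blast
  then obtain F where "F \<in> K" "A \<subseteq> F" "\<forall>F'\<in>K. F \<subseteq> F' \<longrightarrow> F' = F"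
    using finite_has_maximal2[OF _ assms(2)] by metis
  then show ?thesis unfolding facets_def by blast
qed

text \<open>A facet of the intersection is contained in some ridge \<open>Fs ! k - {x}\<close> that
  also belongs to the intersection, hence equals it.\<close>

lemma shellable_if_comb_shellable:
  assumes "comb_shellable K"
  shows "shellable K"
proof -
  from assms obtain Fs where K: "abstract_complex K"
    and Fs: "distinct Fs" "set Fs = facets K" "shelling_from {} Fs"
    unfolding comb_shellable_def by blast
  have "pure_of_dim (generated_complex {Fs ! k} \<inter> generated_complex (set (take k Fs)))
             (face_dim (Fs ! k) - 1)" (is "pure_of_dim ?I _")
    if k: "0 < k" "k < length Fs" for k
    unfolding pure_of_dim_def
  proof (intro conjI ballI)
    have "Fs ! 0 \<in> set (take k Fs)"
      using k by (auto simp: in_set_conv_nth)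
    then have "{} \<in> ?I" unfolding generated_complex_def by auto
    then show "?I \<noteq> {}" by blast
  next
    fix A assume "A \<in> facets ?I"
    then have A: "A \<in> ?I" and max: "\<And>B. B \<in> ?I \<Longrightarrow> A \<subseteq> B \<Longrightarrow> B = A"
      unfolding facets_def by auto
    from A obtain E where E: "E \<in> set (take k Fs)" "A \<subseteq> E" "A \<subseteq> Fs ! k"
      unfolding generated_complex_def by auto
    then obtain F' x where F': "F' \<in> set (take k Fs)" "x \<in> Fs ! k - E" "Fs ! k - {x} \<subseteq> F'"
      using shelling_from_nth[OF Fs(3) k(2), of E] by auto
    have "Fs ! k - {x} \<in> ?I" using F' unfolding generated_complex_def by auto
    then have "A = Fs ! k - {x}" using max E F' by blast
    moreover have "Fs ! k \<in> K" using Fs(2) k unfolding facets_def by force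
    then have "finite (Fs ! k)" using K finite_face by blast
    ultimately show "face_dim A = face_dim (Fs ! k) - 1"
      using F'(2) card_Suc_Diff1[of "Fs ! k" x] unfolding face_dim_def by auto
  qed
  then show ?thesis unfolding shellable_def using K Fs by blast
qed

lemma comb_shellable_Pow:
  assumes "finite V"
  shows "comb_shellable (Pow V)"
proof -
  have "facets (Pow V) = {V}" unfolding facets_def by auto
  moreover have "abstract_complex (Pow V)"
    using assms unfolding abstract_complex_def by (simp add: subset_trans)
  ultimately show ?thesis unfolding comb_shellable_def by (intro conjI exI[of _ "[V]"]) simp_all
qed

text \<open>The complex without even the empty face ends the recursion below when the threshold is
  out of reach.\<close>

lemma comb_shellable_empty: "comb_shellable {}"
  unfolding comb_shellable_def abstract_complex_def facets_def by simp

text \<open>By the shedding condition, facets of the deletion are facets of \<open>K\<close>; the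
  others are \<open>x\<close> joined to facets of the link. The former are listed first, and each
  link face lies in one of them.\<close>

lemma comb_shellable_shed:
  assumes K: "abstract_complex K"
    and del: "comb_shellable {A \<in> K. x \<notin> A}"
    and link: "comb_shellable {A. x \<notin> A \<and> insert x A \<in> K}"
    and shed: "\<And>F. F \<in> facets {A \<in> K. x \<notin> A} \<Longrightarrow> insert x F \<notin> K"
  shows "comb_shellable K"
proof -
  let ?del = "{A \<in> K. x \<notin> A}" and ?link = "{A. x \<notin> A \<and> insert x A \<in> K}"
  from del obtain Ds where Ds: "distinct Ds" "set Ds = facets ?del" "shelling_from {} Ds"
    unfolding comb_shellable_def by blast
  from link obtain Ls where Ls: "distinct Ls" "set Ls = facets ?link" "shelling_from {} Ls"
    unfolding comb_shellable_def by blast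
  have xD: "x \<notin> F" if "F \<in> set Ds" for F using that Ds(2) unfolding facets_def by auto
  have xL: "x \<notin> F" if "F \<in> set Ls" for F using that Ls(2) unfolding facets_def by auto
  have sub: "A \<in> K" if "A \<subseteq> B" "B \<in> K" for A B
    using K that unfolding abstract_complex_def by blast
  have fac: "facets K = facets ?del \<union> insert x ` facets ?link"
  proof (intro equalityI subsetI)
    fix F assume F: "F \<in> facets K"
    show "F \<in> facets ?del \<union> insert x ` facets ?link"
    proof (cases "x \<in> F")
      case True
      have "F - {x} \<in> facets ?link" unfolding facets_def
      proof (intro CollectI conjI ballI impI)
        show "x \<notin> F - {x}" by simp
        show "insert x (F - {x}) \<in> K" using F True unfolding facets_def by (simp add: insert_absorb)
        fix F' assume "F' \<in> ?link" "F - {x} \<subseteq> F'"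
        then have "insert x F' \<in> K" "F \<subseteq> insert x F'" by auto
        then have "insert x F' = F" using F unfolding facets_def by simp
        then show "F' = F - {x}" using \<open>F' \<in> ?link\<close> by auto
      qed
      moreover have "F = insert x (F - {x})" using True by blast
      ultimately show ?thesis by (intro UnI2 image_eqI)
    next
      case False
      then show ?thesis using F unfolding facets_def by auto
    qed
  next
    fix F assume "F \<in> facets ?del \<union> insert x ` facets ?link"
    then show "F \<in> facets K"
    proof
      assume F: "F \<in> facets ?del"
      have "F' = F" if "F' \<in> K" "F \<subseteq> F'" for F'
      proof (cases "x \<in> F'")
        case True
        then have "insert x F \<in> K" using that sub by blast
        then show ?thesis using shed[OF F] by blast
      next
        case False
        then show ?thesis using F that unfolding facets_def by blast
      qed
      then show ?thesis using F unfolding facets_def by blast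
    next
      assume "F \<in> insert x ` facets ?link"
      then obtain L where L: "L \<in> facets ?link" "F = insert x L" by blast
      have "F' = F" if "F' \<in> K" "F \<subseteq> F'" for F'
      proof -
        have "insert x (F' - {x}) = F'" using that L by auto
        then have "F' - {x} \<in> ?link" using that by simp
        moreover have "L \<subseteq> F' - {x}" using L that unfolding facets_def by auto
        ultimately have "F' - {x} = L" using L(1) unfolding facets_def by blast
        then show ?thesis using L \<open>insert x (F' - {x}) = F'\<close> by simp
      qed
      then show ?thesis using L unfolding facets_def by blast
    qed
  qed
  have "shelling_from (set Ds \<union> insert x ` {}) (map (insert x) Ls)"
  proof (rule shelling_from_map_insert[OF Ls(3)])
    fix F assume "F \<in> set Ls"
    then have "F \<in> ?del" using Ls(2) sub[of F "insert x F"] unfolding facets_def by blast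
    moreover have "abstract_complex ?del" using del unfolding comb_shellable_def by blast
    ultimately show "\<exists>F'\<in>set Ds. F \<subseteq> F'" unfolding Ds(2) by (rule face_subset_facet[rotated])
  qed (use xD xL in auto)
  then have "shelling_from {} (Ds @ map (insert x) Ls)"
    using Ds(3) by (simp add: shelling_from_append)
  moreover have "inj_on (insert x) (set Ls)" using xL by (intro inj_onI) (metis insert_ident)
  then have "distinct (Ds @ map (insert x) Ls)"
    using Ds Ls xD by (auto simp: distinct_map)
  moreover have "set (Ds @ map (insert x) Ls) = facets K"
    using fac Ds Ls by simp
  ultimately show ?thesis using K unfolding comb_shellable_def by blast
qed

section \<open>Coverings by laminar families\<close>

definition laminar :: "'a set \<Rightarrow> ('a \<Rightarrow> 'b set) \<Rightarrow> bool" where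
  "laminar V D \<longleftrightarrow> (\<forall>u\<in>V. \<forall>v\<in>V. D u \<subseteq> D v \<or> D v \<subseteq> D u \<or> D u \<inter> D v = {})"

text \<open>Induction on \<open>card V\<close>, shedding an \<open>x\<close> with largest
  \<open>D x\<close>. In the deletion \<open>x\<close> is always removed, so \<open>D x\<close> is
  covered and can be subtracted from the other members; in the link \<open>x\<close> is never
  removed.\<close>

lemma comb_shellable_laminar:
  fixes D :: "'a \<Rightarrow> 'b set"
  assumes "finite V" "laminar V D" "\<And>v. v \<in> V \<Longrightarrow> finite (D v)"
  shows "comb_shellable {A. A \<subseteq> V \<and> q \<le> card (\<Union>(D ` (V - A)))}"
  using assms
proof (induction "card V" arbitrary: V D q rule: less_induct)
  case less
  let ?K = "{A. A \<subseteq> V \<and> q \<le> card (\<Union>(D ` (V - A)))}"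
  have fin: "finite (\<Union>(D ` X))" if "X \<subseteq> V" for X
    using that less.prems finite_subset by blast
  show ?case
  proof (cases "q = 0 \<or> V = {}")
    case True
    then show ?thesis
    proof
      assume "q = 0"
      then have "?K = Pow V" by auto
      then show ?thesis using comb_shellable_Pow[OF less.prems(1)] by simp
    next
      assume V: "V = {}"
      then have "?K = Pow {} \<or> ?K = {}" by auto
      then show ?thesis
        by (elim disjE) (simp_all only: comb_shellable_Pow[OF finite.emptyI] comb_shellable_empty)
    qed
  next
    case False
    then obtain x where x: "x \<in> V" "\<And>v. v \<in> V \<Longrightarrow> card (D v) \<le> card (D x)"
      using obtains_MAX[of V "\<lambda>v. card (D v)"] less.prems(1)
      by (metis Max_ge finite_imageI image_eqI)
    \<comment> \<open>A member containing \<open>D x\<close> equals it by the choice of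
      \<open>x\<close>.\<close>
    have sub: "D v \<subseteq> D x \<or> D v \<inter> D x = {}" if "v \<in> V" for v
    proof -
      have "D x \<subseteq> D v \<Longrightarrow> D v = D x"
        using x(2)[OF that] less.prems(3)[OF that] card_seteq by blast
      then show ?thesis using less.prems(2) that x(1) unfolding laminar_def by blast
    qed
    have lt: "card (V - {x}) < card V" using x less.prems(1) by (meson card_Diff1_less)
    have cardU: "card (\<Union>(D ` insert x X)) = card (D x) + card (\<Union>((\<lambda>v. D v - D x) ` X))"
      if "X \<subseteq> V" for X
    proof -
      have "\<Union>(D ` insert x X) = D x \<union> \<Union>((\<lambda>v. D v - D x) ` X)" by auto
      moreover have "finite (\<Union>((\<lambda>v. D v - D x) ` X))"
        using fin[OF that] by (rule rev_finite_subset) auto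
      moreover have "D x \<inter> \<Union>((\<lambda>v. D v - D x) ` X) = {}" by blast
      ultimately show ?thesis using less.prems(3)[OF x(1)] by (simp only: card_Un_disjoint)
    qed
    show ?thesis
    proof (rule comb_shellable_shed[where x = x])
      have "B \<in> ?K" if "A \<in> ?K" "B \<subseteq> A" for A B
      proof -
        have "\<Union>(D ` (V - A)) \<subseteq> \<Union>(D ` (V - B))" using that by auto
        then have "card (\<Union>(D ` (V - A))) \<le> card (\<Union>(D ` (V - B)))"
          by (rule card_mono[rotated]) (use fin in auto)
        then show ?thesis using that by auto
      qed
      moreover have "finite (\<Union>?K)" using less.prems(1) by (rule rev_finite_subset) auto
      ultimately show "abstract_complex ?K" unfolding abstract_complex_def by blast
    next
      \<comment> \<open>The truncated subtraction below is harmless: for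
        \<open>q \<le> card (D x)\<close> the set \<open>D x\<close> alone meets the
        threshold.\<close>
      let ?D' = "\<lambda>v. D v - D x"
      have "{A \<in> ?K. x \<notin> A} =
        {A. A \<subseteq> V - {x} \<and> q - card (D x) \<le> card (\<Union>(?D' ` (V - {x} - A)))}" (is "?l = ?r")
      proof -
        have "q \<le> card (\<Union>(D ` (V - A))) \<longleftrightarrow>
            q - card (D x) \<le> card (\<Union>(?D' ` (V - {x} - A)))" if "x \<notin> A" for A
        proof -
          have "V - A = insert x (V - {x} - A)" using x(1) that by auto
          moreover have "V - {x} - A \<subseteq> V" by blast
          ultimately show ?thesis using cardU by (simp only: le_diff_conv add.commute)
        qed
        then show ?thesis by auto
      qed
      moreover have "comb_shellable ?r"
      proof (rule less.hyps[OF lt])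
        \<comment> \<open>Each member vanishes or stays intact, so laminarity survives.\<close>
        have "?D' v = {} \<or> ?D' v = D v" if "v \<in> V" for v using sub[OF that] by auto
        then show "laminar (V - {x}) ?D'"
          using less.prems(2) unfolding laminar_def by (metis DiffD1 bot.extremum)
      qed (use less.prems in auto)
      ultimately show "comb_shellable ?l" by simp
    next
      have "{A. x \<notin> A \<and> insert x A \<in> ?K} =
        {A. A \<subseteq> V - {x} \<and> q \<le> card (\<Union>(D ` (V - {x} - A)))}"
        using x(1) by (auto simp: Diff_insert2[symmetric] set_diff_eq)
      moreover have "comb_shellable {A. A \<subseteq> V - {x} \<and> q \<le> card (\<Union>(D ` (V - {x} - A)))}"
        by (rule less.hyps[OF lt]) (use less.prems in \<open>auto simp: laminar_def\<close>)
      ultimately show "comb_shellable {A. x \<notin> A \<and> insert x A \<in> ?K}" by simp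
    next
      fix F assume F: "F \<in> facets {A \<in> ?K. x \<notin> A}"
      show "insert x F \<notin> ?K"
      proof
        assume K: "insert x F \<in> ?K"
        define R where "R = V - insert x F"
        have FV: "F \<subseteq> V" "x \<notin> F" using F unfolding facets_def by auto
        have q: "q \<le> card (\<Union>(D ` R))" using K unfolding R_def by simp
        then have "R \<noteq> {}" using False by auto
        have RV: "R \<subseteq> V" unfolding R_def by auto
        \<comment> \<open>Exchange of some \<open>v\<close> for \<open>x\<close>: a member inside
          \<open>D x\<close> is given up at no loss; if there is none, all are disjoint from
          \<open>D x\<close>, which replaces a member of at most its size. Then
          \<open>insert v F\<close> is a larger face of the deletion.\<close>
        have "\<exists>v\<in>R. card (\<Union>(D ` R)) \<le> card (\<Union>(D ` insert x (R - {v})))"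
        proof (cases "\<exists>v\<in>R. D v \<subseteq> D x")
          case True
          then obtain v where v: "v \<in> R" "D v \<subseteq> D x" by blast
          then have "\<Union>(D ` R) \<subseteq> \<Union>(D ` insert x (R - {v}))" by auto
          then have "card (\<Union>(D ` R)) \<le> card (\<Union>(D ` insert x (R - {v})))"
            using fin[of "insert x (R - {v})"] x(1) RV by (intro card_mono) auto
          then show ?thesis using v by blast
        next
          case False
          then have dis: "D v \<inter> D x = {}" if "v \<in> R" for v using sub that RV by blast
          obtain v where v: "v \<in> R" using \<open>R \<noteq> {}\<close> by blast
          have "\<Union>(D ` R) = D v \<union> \<Union>(D ` (R - {v}))" using v by auto
          then have "card (\<Union>(D ` R)) \<le> card (D v) + card (\<Union>(D ` (R - {v})))"
            using card_Un_le by metis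
          also have "\<dots> \<le> card (D x) + card (\<Union>(D ` (R - {v})))"
            using x(2) v RV by auto
          also have "\<dots> = card (D x \<union> \<Union>(D ` (R - {v})))"
            using dis less.prems(3)[OF x(1)] fin[of "R - {v}"] RV
            by (subst card_Un_disjoint) (auto simp: Int_commute)
          finally show ?thesis using v by auto
        qed
        then obtain v where v: "v \<in> R" "q \<le> card (\<Union>(D ` insert x (R - {v})))"
          using q le_trans by blast
        have "V - insert v F = insert x (R - {v})" using v(1) x(1) FV unfolding R_def by auto
        then have "insert v F \<in> {A \<in> ?K. x \<notin> A}" using v FV unfolding R_def by auto
        then have "insert v F = F" using F unfolding facets_def by blast
        then show False using v(1) unfolding R_def by auto
      qed
    qed
  qed
qed

section \<open>Connected sets of a forest\<close>

text \<open>Connectedness through cuts instead of paths; the empty set counts as linked.\<close>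

definition linked :: "('a \<Rightarrow> 'a \<Rightarrow> bool) \<Rightarrow> 'a set \<Rightarrow> bool" where
  "linked adj X \<longleftrightarrow> (\<forall>Y. Y \<subset> X \<and> Y \<noteq> {} \<longrightarrow> (\<exists>y\<in>Y. \<exists>x\<in>X - Y. adj y x))"

definition separated :: "('a \<Rightarrow> 'a \<Rightarrow> bool) \<Rightarrow> 'a set \<Rightarrow> 'a set \<Rightarrow> bool" where
  "separated adj X Y \<longleftrightarrow> (\<forall>x\<in>X. \<forall>y\<in>Y. \<not> adj x y)"

lemma linkedI:
  "(\<And>Y. Y \<subset> X \<Longrightarrow> Y \<noteq> {} \<Longrightarrow> \<exists>y\<in>Y. \<exists>x\<in>X - Y. adj y x) \<Longrightarrow> linked adj X"
  unfolding linked_def by blast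

lemma linkedD:
  "linked adj X \<Longrightarrow> Y \<subset> X \<Longrightarrow> Y \<noteq> {} \<Longrightarrow> \<exists>y\<in>Y. \<exists>x\<in>X - Y. adj y x"
  unfolding linked_def by blast

lemma linked_subset_if_separated:
  assumes "linked adj T" "T \<inter> C \<noteq> {}" "separated adj (T \<inter> C) (T - C)"
  shows "T \<subseteq> C"
proof (rule ccontr)
  assume "\<not> T \<subseteq> C"
  then have "T \<inter> C \<subset> T" by blast
  then obtain y x where "y \<in> T \<inter> C" "x \<in> T - T \<inter> C" "adj y x"
    using linkedD[OF assms(1) _ assms(2)] by blast
  then show False using assms(3) unfolding separated_def by blast
qed

lemma separated_mono: "separated adj X Y \<Longrightarrow> X' \<subseteq> X \<Longrightarrow> Y' \<subseteq> Y \<Longrightarrow> separated adj X' Y'"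
  unfolding separated_def by blast

lemma linked_clique:
  assumes "\<And>a b. a \<in> K \<Longrightarrow> b \<in> K \<Longrightarrow> a \<noteq> b \<Longrightarrow> adj a b"
  shows "linked adj K"
proof (rule linkedI)
  fix Y assume Y: "Y \<subset> K" "Y \<noteq> {}"
  then obtain y x where "y \<in> Y" "x \<in> K - Y" by blast
  moreover then have "adj y x" using Y by (intro assms) auto
  ultimately show "\<exists>y\<in>Y. \<exists>x\<in>K - Y. adj y x" by blast
qed

lemma ex_maximal_set:
  assumes "finite S" "X \<in> S"
  shows "\<exists>C\<in>S. X \<subseteq> C \<and> (\<forall>C'\<in>S. C \<subseteq> C' \<longrightarrow> C' = C)"
  using finite_has_maximal2[OF assms] by metis

text \<open>Acyclicity is encoded in \<open>unique_neighbour\<close>: two neighbours of an outside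
  vertex would be joined by a path in the connected set and close a cycle.\<close>

locale forest_adj =
  fixes adj :: "'a \<Rightarrow> 'a \<Rightarrow> bool"
  assumes adj_sym: "adj u v \<Longrightarrow> adj v u"
    and adj_irrefl: "\<not> adj v v"
    and unique_neighbour: "linked adj X \<Longrightarrow> v \<notin> X \<Longrightarrow> a \<in> X \<Longrightarrow> b \<in> X \<Longrightarrow> adj a v \<Longrightarrow> adj b v \<Longrightarrow> a = b"
begin

abbreviation conn :: "'a set \<Rightarrow> bool" where "conn \<equiv> linked adj"
abbreviation sep :: "'a set \<Rightarrow> 'a set \<Rightarrow> bool" where "sep \<equiv> separated adj"

lemma sep_sym: "sep X Y \<Longrightarrow> sep Y X"
  using adj_sym unfolding separated_def by blast

lemma conn_singleton: "conn {v}"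
  by (rule linked_clique) simp

lemma conn_Un:
  assumes "conn X" "conn Y" "a \<in> X" "b \<in> Y" "adj a b \<or> a = b"
  shows "conn (X \<union> Y)"
proof (rule linkedI)
  fix Z assume Z: "Z \<subset> X \<union> Y" "Z \<noteq> {}"
  show "\<exists>y\<in>Z. \<exists>x\<in>X \<union> Y - Z. adj y x"
  proof (rule ccontr)
    assume "\<not> ?thesis"
    then have s: "sep Z (X \<union> Y - Z)" unfolding separated_def by blast
    have X: "X \<subseteq> Z \<or> X \<inter> Z = {}"
      using linked_subset_if_separated[OF assms(1), of Z] separated_mono[OF s, of "X \<inter> Z" "X - Z"]
      by blast
    have Y: "Y \<subseteq> Z \<or> Y \<inter> Z = {}"
      using linked_subset_if_separated[OF assms(2), of Z] separated_mono[OF s, of "Y \<inter> Z" "Y - Z"]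
      by blast
    \<comment> \<open>Exactly one of \<open>X\<close> and \<open>Y\<close> lies in \<open>Z\<close>,
      since \<open>Z\<close> is nonempty and proper.\<close>
    have "a \<in> Z \<and> b \<notin> Z \<or> b \<in> Z \<and> a \<notin> Z" using X Y Z assms(3,4) by blast
    then show False using s assms(3-5) adj_sym unfolding separated_def by blast
  qed
qed

lemma conn_insert: "conn X \<Longrightarrow> a \<in> X \<Longrightarrow> adj a v \<Longrightarrow> conn (insert v X)"
  using conn_Un[OF _ conn_singleton, of X a v v] by simp

text \<open>A cut of \<open>T - {v}\<close> becomes a cut of \<open>T\<close> once \<open>v\<close>
  is put on the side of its only possible neighbour \<open>a\<close>; no edge at \<open>v\<close>
  then crosses it.\<close>

lemma conn_Diff_leaf:
  assumes "conn T" "\<And>b. b \<in> T \<Longrightarrow> adj b v \<Longrightarrow> b = a"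
  shows "conn (T - {v})"
proof (cases "v \<in> T")
  case True
  show ?thesis
  proof (rule linkedI)
    fix Y assume Y: "Y \<subset> T - {v}" "Y \<noteq> {}"
    show "\<exists>y\<in>Y. \<exists>x\<in>T - {v} - Y. adj y x"
    proof (cases "a \<in> Y")
      case True
      have "insert v Y \<subset> T" using \<open>v \<in> T\<close> Y by blast
      then obtain y x where yx: "y \<in> insert v Y" "x \<in> T - insert v Y" "adj y x"
        using linkedD[OF assms(1), of "insert v Y"] by auto
      then have "y \<noteq> v" using assms(2)[of x] adj_sym True by blast
      then show ?thesis using yx by blast
    next
      case False
      have "Y \<subset> T" using Y by blast
      then obtain y x where yx: "y \<in> Y" "x \<in> T - Y" "adj y x"
        using linkedD[OF assms(1), of Y] Y(2) by auto
      moreover have "x \<noteq> v" using assms(2)[of y] yx False Y by blast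
      ultimately show ?thesis by blast
    qed
  qed
qed (use assms in simp)

text \<open>A maximal connected subset of \<open>W\<close> containing \<open>T\<close> has no edge
  into the rest of \<open>W\<close>.\<close>

lemma ex_component:
  assumes "finite W" "T \<subseteq> W" "conn T" "T \<noteq> {}"
  obtains C where "T \<subseteq> C" "C \<subseteq> W" "conn C" "sep C (W - C)"
proof -
  define S where "S = {C. T \<subseteq> C \<and> C \<subseteq> W \<and> conn C}"
  have "finite S" using assms(1) unfolding S_def by simp
  moreover have "T \<in> S" using assms unfolding S_def by simp
  ultimately obtain C where "C \<in> S" and max: "\<forall>C'\<in>S. C \<subseteq> C' \<longrightarrow> C' = C"
    using ex_maximal_set[of S T] by blast
  then have C: "T \<subseteq> C" "C \<subseteq> W" "conn C" unfolding S_def by simp_all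
  have "\<not> adj c w" if "c \<in> C" "w \<in> W - C" for c w
  proof
    assume "adj c w"
    then have "insert w C \<in> S" using C that conn_insert unfolding S_def by auto
    then show False using max that by blast
  qed
  then have "sep C (W - C)" unfolding separated_def by blast
  then show ?thesis by (rule that[OF C])
qed

section \<open>Branches cut off from a clique\<close>

lemma conn_grow_induct [consumes 4, case_names base grow]:
  assumes "finite C" "conn C" "K \<subseteq> C" "K \<noteq> {}" and "P K"
    and grow: "\<And>X v a. K \<subseteq> X \<Longrightarrow> X \<subseteq> C \<Longrightarrow> v \<in> C - X \<Longrightarrow> a \<in> X \<Longrightarrow> adj a v \<Longrightarrow> P X \<Longrightarrow> P (insert v X)"
  shows "P C"
proof -
  define S where "S = {X. K \<subseteq> X \<and> X \<subseteq> C \<and> P X}"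
  have "finite S" using assms(1) unfolding S_def by simp
  moreover have "K \<in> S" using assms unfolding S_def by simp
  ultimately obtain X where "X \<in> S" and max: "\<forall>X'\<in>S. X \<subseteq> X' \<longrightarrow> X' = X"
    using ex_maximal_set[of S K] by blast
  then have X: "K \<subseteq> X" "X \<subseteq> C" "P X" unfolding S_def by simp_all
  have "X = C"
  proof (rule ccontr)
    assume "X \<noteq> C"
    then have "X \<subset> C" "X \<noteq> {}" using X(1,2) assms(4) by auto
    then obtain a v where av: "a \<in> X" "v \<in> C - X" "adj a v" using linkedD[OF assms(2)] by blast
    then have "P (insert v X)" using X grow by blast
    then have "insert v X \<in> S" using X av unfolding S_def by blast
    then show False using max av by blast
  qed
  then show ?thesis using X by simp
qed

text \<open>\<^term>\<open>D s\<close> consists of the vertices that removing \<^term>\<open>s\<close> cuts off from the clique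
  \<^term>\<open>K\<close>.\<close>

definition branches :: "'a set \<Rightarrow> 'a set \<Rightarrow> ('a \<Rightarrow> 'a set) \<Rightarrow> bool" where
  "branches K C D \<longleftrightarrow> laminar C D \<and> (\<forall>s\<in>C. D s \<subseteq> C) \<and>
    (\<forall>A\<subseteq>C. C - \<Union>(D ` (C - A)) \<subseteq> A \<and> conn (C - \<Union>(D ` (C - A))) \<and>
      (\<forall>T\<subseteq>A. conn T \<and> T \<inter> K \<noteq> {} \<longrightarrow> T \<subseteq> C - \<Union>(D ` (C - A))))"

lemma branches_clique:
  assumes clique: "\<And>a b. a \<in> K \<Longrightarrow> b \<in> K \<Longrightarrow> a \<noteq> b \<Longrightarrow> adj a b"
  shows "branches K K (\<lambda>s. {s})"
proof -
  have "K - \<Union>((\<lambda>s. {s}) ` (K - A)) = A" if "A \<subseteq> K" for A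
    using that by auto
  moreover have "conn A" if "A \<subseteq> K" for A
    using that clique by (intro linked_clique) auto
  moreover have "laminar K (\<lambda>s. {s})" unfolding laminar_def by blast
  ultimately show ?thesis unfolding branches_def by simp
qed

text \<open>By \<open>unique_neighbour\<close> the new vertex \<open>v\<close> is a leaf at
  \<open>a\<close>, so it is cut off exactly by itself and by whatever cuts off
  \<open>a\<close>.\<close>

lemma branches_insert:
  assumes connX: "conn X" and KX: "K \<subseteq> X" and v: "v \<notin> X" "a \<in> X" "adj a v"
    and D: "branches K X D"
  shows "branches K (insert v X) (\<lambda>s. if s = v then {v} else if a \<in> D s then insert v (D s) else D s)"
proof -
  have lam: "laminar X D" and DX: "\<And>s. s \<in> X \<Longrightarrow> D s \<subseteq> X"
    using D unfolding branches_def by simp_all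
  have *: "\<And>A. A \<subseteq> X \<Longrightarrow> X - \<Union>(D ` (X - A)) \<subseteq> A \<and> conn (X - \<Union>(D ` (X - A))) \<and>
      (\<forall>T\<subseteq>A. conn T \<and> T \<inter> K \<noteq> {} \<longrightarrow> T \<subseteq> X - \<Union>(D ` (X - A)))"
    using D unfolding branches_def by simp
  note vX = v(1)
  define D' where "D' s = (if s = v then {v} else if a \<in> D s then insert v (D s) else D s)" for s
  have D's: "D' s = (if a \<in> D s then insert v (D s) else D s)" if "s \<in> X" for s
    using vX that unfolding D'_def by auto
  have D'v: "D' v = {v}" unfolding D'_def by simp
  have unique: "b = a" if "b \<in> insert v X" "adj b v" "b \<noteq> v" for b
    using unique_neighbour[OF connX vX] that v by blast
  have "laminar (insert v X) D'"
    unfolding laminar_def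
  proof (intro ballI)
    have lamv: "D' v \<subseteq> D' s \<or> D' v \<inter> D' s = {}" if "s \<in> X" for s
      using DX[OF that] vX unfolding D'v D's[OF that] by auto
    fix s t assume st: "s \<in> insert v X" "t \<in> insert v X"
    consider "s = v" "t = v" | "s = v" "t \<in> X" | "s \<in> X" "t = v" | "s \<in> X" "t \<in> X"
      using st by blast
    then show "D' s \<subseteq> D' t \<or> D' t \<subseteq> D' s \<or> D' s \<inter> D' t = {}"
    proof cases
      case 1
      then show ?thesis by simp
    next
      case 2
      then show ?thesis using lamv[of t] by blast
    next
      case 3
      then show ?thesis using lamv[of s] by blast
    next
      case 4
      have "D s \<subseteq> D t \<or> D t \<subseteq> D s \<or> D s \<inter> D t = {}" using lam 4 unfolding laminar_def by blast
      then show ?thesis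
        using DX[OF 4(1)] DX[OF 4(2)] vX unfolding D's[OF 4(1)] D's[OF 4(2)]
        by (elim disjE) (auto split: if_splits)
    qed
  qed
  moreover have "D' s \<subseteq> insert v X" if "s \<in> insert v X" for s
    using that D'v D's[of s] DX[of s] by (cases "s = v") auto
  moreover have "insert v X - \<Union>(D' ` (insert v X - A)) \<subseteq> A \<and>
      conn (insert v X - \<Union>(D' ` (insert v X - A))) \<and>
      (\<forall>T\<subseteq>A. conn T \<and> T \<inter> K \<noteq> {} \<longrightarrow> T \<subseteq> insert v X - \<Union>(D' ` (insert v X - A)))"
    if A: "A \<subseteq> insert v X" for A
  proof -
    \<comment> \<open>\<open>M\<close> is the part of \<open>A - {v}\<close> not cut off from
      \<open>K\<close>; \<open>v\<close> rejoins it just when \<open>v\<close> is kept and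
      \<open>a\<close> is in \<open>M\<close>.\<close>
    define M where "M = X - \<Union>(D ` (X - (A - {v})))"
    have M: "M \<subseteq> A - {v}" "conn M"
      and MT: "\<And>T. T \<subseteq> A - {v} \<Longrightarrow> conn T \<Longrightarrow> T \<inter> K \<noteq> {} \<Longrightarrow> T \<subseteq> M"
      using *[of "A - {v}"] A unfolding M_def by auto
    have XA: "X - (A - {v}) = X - A" using vX by auto
    have eq: "insert v X - \<Union>(D' ` (insert v X - A)) = (if v \<in> A \<and> a \<in> M then insert v M else M)"
      (is "?M' = _")
    proof (rule set_eqI)
      fix y
      have mem: "y \<in> ?M' \<longleftrightarrow> y \<in> insert v X \<and> (v \<notin> A \<longrightarrow> y \<noteq> v) \<and> (\<forall>s\<in>X - A. y \<notin> D' s)"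
        using D'v vX by auto
      show "y \<in> ?M' \<longleftrightarrow> y \<in> (if v \<in> A \<and> a \<in> M then insert v M else M)"
      proof (cases "y = v")
        case True
        have "v \<in> D' s \<longleftrightarrow> a \<in> D s" if "s \<in> X" for s
          using DX[OF that] vX unfolding D's[OF that] by auto
        then have "(\<forall>s\<in>X - A. v \<notin> D' s) \<longleftrightarrow> a \<in> M" using v(2) unfolding M_def XA by simp
        moreover have "v \<notin> M" using vX unfolding M_def by simp
        ultimately show ?thesis using mem unfolding True by simp
      next
        case False
        have "y \<in> D' s \<longleftrightarrow> y \<in> D s" if "s \<in> X" for s
          using False unfolding D's[OF that] by simp
        then have "(\<forall>s\<in>X - A. y \<notin> D' s) \<longleftrightarrow> (\<forall>s\<in>X - A. y \<notin> D s)" by simp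
        then have "y \<in> ?M' \<longleftrightarrow> y \<in> M" using mem False unfolding M_def XA by simp
        then show ?thesis using False by simp
      qed
    qed
    have "T \<subseteq> ?M'" if T: "T \<subseteq> A" "conn T" "T \<inter> K \<noteq> {}" for T
    proof (cases "v \<in> T")
      case False
      then have "T \<subseteq> M" using MT T by blast
      then show ?thesis unfolding eq by auto
    next
      case True
      have "conn (T - {v})"
        using T(1,2) A unique adj_irrefl by (intro conn_Diff_leaf[of T v a]) auto
      moreover have "(T - {v}) \<inter> K \<noteq> {}" using T(3) vX KX by blast
      ultimately have TM: "T - {v} \<subseteq> M" using T(1) by (intro MT) auto
      \<comment> \<open>As \<open>v\<close> is not in \<open>K\<close>, the set \<open>T\<close> has
        further vertices, and its edge at \<open>v\<close> can only lead to
        \<open>a\<close>.\<close>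
      have "{v} \<subset> T" using T(3) True vX KX by blast
      then obtain x where x: "x \<in> T - {v}" "adj v x" using linkedD[OF T(2)] by blast
      then have "x = a" using unique T(1) A adj_sym by blast
      then show ?thesis using TM x T(1) True unfolding eq by auto
    qed
    moreover have "conn ?M'" using M conn_insert[OF M(2) _ v(3)] unfolding eq by auto
    moreover have "?M' \<subseteq> A" using M unfolding eq by auto
    ultimately show ?thesis by blast
  qed
  ultimately show ?thesis unfolding branches_def D'_def by simp
qed

lemma ex_branches:
  assumes "finite C" "conn C" "K \<subseteq> C" "K \<noteq> {}"
    and clique: "\<And>a b. a \<in> K \<Longrightarrow> b \<in> K \<Longrightarrow> a \<noteq> b \<Longrightarrow> adj a b"
  shows "\<exists>D. branches K C D"
proof -
  have "conn C \<and> (\<exists>D. branches K C D)" using assms(1-4)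
  proof (induction rule: conn_grow_induct)
    case base
    show ?case using branches_clique linked_clique clique by metis
  next
    case (grow X v a)
    then obtain D where "conn X" "branches K X D" by blast
    then show ?case using branches_insert[of X K v a D] conn_insert[of X a v] grow by blast
  qed
  then show ?thesis by blast
qed

section \<open>The complexes of a forest\<close>

definition indep :: "nat \<Rightarrow> 'a set \<Rightarrow> bool" where
  "indep r A \<longleftrightarrow> (\<forall>T\<subseteq>A. conn T \<longrightarrow> card T \<le> r)"

text \<open>The link of the face \<^term>\<open>R\<close> in the \<^term>\<open>r\<close>-independence complex of the induced subgraph
  on \<^term>\<open>W\<close>.\<close>

definition Cx :: "nat \<Rightarrow> 'a set \<Rightarrow> 'a set \<Rightarrow> 'a set set" where
  "Cx r R W = {A. A \<subseteq> W - R \<and> indep r (A \<union> R)}"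

lemma indep_mono: "indep r B \<Longrightarrow> A \<subseteq> B \<Longrightarrow> indep r A"
  unfolding indep_def by blast

lemma abstract_complex_Cx:
  assumes "finite W"
  shows "abstract_complex (Cx r R W)"
proof -
  have "\<Union>(Cx r R W) \<subseteq> W" unfolding Cx_def by blast
  moreover have "B \<in> Cx r R W" if "A \<in> Cx r R W" "B \<subseteq> A" for A B
    using that indep_mono[of r "A \<union> R" "B \<union> R"] unfolding Cx_def by blast
  moreover have "finite (\<Union>(Cx r R W))" using calculation(1) assms by (rule finite_subset)
  ultimately show ?thesis unfolding abstract_complex_def by simp
qed

lemma conn_subset_component:
  assumes "conn T" "T \<subseteq> W" "sep C (W - C)" "T \<inter> C \<noteq> {}"
  shows "T \<subseteq> C"
  by (rule linked_subset_if_separated[OF assms(1,4) separated_mono[OF assms(3)]]) (use assms(2) in auto)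

text \<open>Independence asks for a set of removed vertices that meets \<^term>\<open>C1\<close> and cuts off enough of
  \<^term>\<open>C\<close> from \<^term>\<open>K\<close>. Both are expressed by a single count because \<^term>\<open>C1\<close> weighs
  \<^term>\<open>r + 1\<close>.\<close>

lemma comb_shellable_Cx_if_hit:
  assumes W: "finite W" "R \<subseteq> W"
    and C: "conn C" "C \<subseteq> W" "sep C (W - C)"
    and K: "K \<subseteq> C" "K \<noteq> {}" "\<And>a b. a \<in> K \<Longrightarrow> b \<in> K \<Longrightarrow> a \<noteq> b \<Longrightarrow> adj a b"
    and C1: "conn C1" "C1 \<subseteq> W" "sep C1 (W - C1)" "C1 \<inter> C = {}" "C1 = {} \<or> card C1 = r + 1"
    and hit: "\<And>T. T \<subseteq> W \<Longrightarrow> conn T \<Longrightarrow> r < card T \<Longrightarrow> T \<inter> (K \<union> C1) \<noteq> {}"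
  shows "comb_shellable (Cx r R W)"
proof -
  have fin: "finite C" "finite C1" using W(1) C(2) C1(2) finite_subset by blast+
  obtain D where "branches K C D" using ex_branches[OF fin(1) C(1) K] by blast
  then have lam: "laminar C D" and DC: "\<And>s. s \<in> C \<Longrightarrow> D s \<subseteq> C"
    and D: "\<And>A. A \<subseteq> C \<Longrightarrow> C - \<Union>(D ` (C - A)) \<subseteq> A \<and> conn (C - \<Union>(D ` (C - A))) \<and>
      (\<forall>T\<subseteq>A. conn T \<and> T \<inter> K \<noteq> {} \<longrightarrow> T \<subseteq> C - \<Union>(D ` (C - A)))"
    unfolding branches_def by simp_all
  \<comment> \<open>A removed vertex of \<open>C\<close> covers its branch, one of \<open>C1\<close>
    covers all of \<open>C1\<close>, and any other covers nothing.\<close>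
  define E where "E v = (if v \<in> C then D v else if v \<in> C1 then C1 else {})" for v
  have EC: "E v = D v" if "v \<in> C" for v using that unfolding E_def by simp
  have EC1: "E v = C1" if "v \<in> C1" for v using that C1(4) unfolding E_def by auto
  have E0: "E v = {}" if "v \<notin> C" "v \<notin> C1" for v using that unfolding E_def by simp
  have "laminar W E"
    unfolding laminar_def
  proof (intro ballI)
    fix u v
    show "E u \<subseteq> E v \<or> E v \<subseteq> E u \<or> E u \<inter> E v = {}"
    proof (cases "u \<in> C \<and> v \<in> C")
      case True
      then show ?thesis using lam unfolding laminar_def by (simp add: EC)
    next
      case False
      moreover have "E w \<subseteq> C" if "w \<in> C" for w using DC[OF that] EC[OF that] by simp
      moreover have "E w = C1 \<or> E w = {}" if "w \<notin> C" for w using that unfolding E_def by simp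
      moreover note C1(4)
      ultimately show ?thesis by (cases "u \<in> C"; cases "v \<in> C") (blast+)
    qed
  qed
  then have lamE: "laminar (W - R) E" unfolding laminar_def by blast
  have "indep r (A \<union> R) \<longleftrightarrow> card C + card C1 - r \<le> card (\<Union>(E ` (W - R - A)))"
    if A: "A \<subseteq> W - R" for A
  proof -
    define B where "B = A \<union> R"
    \<comment> \<open>\<open>X\<close> is connected and contains every connected subset of
      \<open>B\<close> meeting \<open>K\<close>, so its size decides about the big sets through
      \<open>K\<close>.\<close>
    define X where "X = C - \<Union>(D ` (C - B))"
    have BW: "B \<subseteq> W" "W - R - A = W - B" using A W unfolding B_def by auto
    have "C - B = C - (B \<inter> C)" by blast
    then have X: "X \<subseteq> B" "conn X" "\<And>T. T \<subseteq> B \<inter> C \<Longrightarrow> conn T \<Longrightarrow> T \<inter> K \<noteq> {} \<Longrightarrow> T \<subseteq> X"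
      using D[of "B \<inter> C"] unfolding X_def by simp_all
    have XC: "X \<subseteq> C" unfolding X_def by blast
    have C1B: "C1 \<subseteq> B \<longrightarrow> C1 = {}" if "indep r B"
    proof
      assume "C1 \<subseteq> B"
      then have "card C1 \<le> r" using that C1(1) unfolding indep_def by blast
      then show "C1 = {}" using C1(5) by auto
    qed
    have ind: "indep r B \<longleftrightarrow> card X \<le> r \<and> (C1 \<subseteq> B \<longrightarrow> C1 = {})"
    proof
      assume "indep r B"
      then show "card X \<le> r \<and> (C1 \<subseteq> B \<longrightarrow> C1 = {})" using X C1B unfolding indep_def by blast
    next
      assume *: "card X \<le> r \<and> (C1 \<subseteq> B \<longrightarrow> C1 = {})"
      show "indep r B" unfolding indep_def
      proof (intro allI impI, rule ccontr)
        fix T assume T: "T \<subseteq> B" "conn T" "\<not> card T \<le> r"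
        then have TW: "T \<subseteq> W" using BW by blast
        then have "T \<inter> K \<noteq> {} \<or> T \<inter> C1 \<noteq> {}" using hit[of T] T by auto
        then show False
        proof
          assume TK: "T \<inter> K \<noteq> {}"
          then have "T \<subseteq> C" using conn_subset_component[OF T(2) TW C(3)] K(1) by blast
          then have "T \<subseteq> X" using X(3)[OF _ T(2) TK] T(1) by blast
          then have "card T \<le> card X" using finite_subset[OF XC fin(1)] by (rule card_mono[rotated])
          then show False using T * by simp
        next
          assume TC1: "T \<inter> C1 \<noteq> {}"
          then have "T \<subseteq> C1" using conn_subset_component[OF T(2) TW C1(3)] by blast
          moreover then have "card C1 \<le> card T" using C1(5) T(3) by auto
          ultimately have "T = C1" using fin(2) card_seteq by blast
          then show False using * T(1) TC1 by blast
        qed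
      qed
    qed
    define Z where "Z = W - B - C - C1"
    have "W - B = (C - B) \<union> (C1 - B) \<union> Z" unfolding Z_def using C(2) C1(2) by blast
    then have "\<Union>(E ` (W - B)) = \<Union>(E ` (C - B)) \<union> \<Union>(E ` (C1 - B)) \<union> \<Union>(E ` Z)"
      by (simp only: UN_Un)
    also have "\<Union>(E ` Z) = {}" using E0 unfolding Z_def by simp
    also have "\<Union>(E ` (C - B)) = C - X" using DC EC unfolding X_def by auto
    also have "\<Union>(E ` (C1 - B)) = (if C1 \<subseteq> B then {} else C1)" using EC1 by auto
    finally have U: "\<Union>(E ` (W - B)) = (C - X) \<union> (if C1 \<subseteq> B then {} else C1)" by simp
    have "card ((C - X) \<union> (if C1 \<subseteq> B then {} else C1)) =
        card (C - X) + card (if C1 \<subseteq> B then {} else C1)"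
      using fin C1(4) by (intro card_Un_disjoint) auto
    also have "card (C - X) = card C - card X"
      using XC fin(1) by (intro card_Diff_subset) (auto intro: finite_subset)
    finally have card: "card (\<Union>(E ` (W - B))) = card C - card X + (if C1 \<subseteq> B then 0 else card C1)"
      unfolding U by simp
    have "card X \<le> card C" using XC fin(1) card_mono by blast
    \<comment> \<open>For nonempty \<open>C1\<close> the threshold is \<open>card C + 1\<close>:
      \<open>C\<close> alone cannot reach it, and once \<open>C1\<close> is covered it says
      \<open>card X \<le> r\<close>. For empty \<open>C1\<close> the threshold
      \<open>card C - r\<close> says the latter as well.\<close>
    then show ?thesis
      using C1(5) ind unfolding BW card B_def[symmetric] by auto
  qed
  then have "Cx r R W = {A. A \<subseteq> W - R \<and> card C + card C1 - r \<le> card (\<Union>(E ` (W - R - A)))}"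
    unfolding Cx_def by blast
  moreover have "finite (E v)" if "v \<in> W - R" for v
    using DC fin finite_subset[of "D v" C] unfolding E_def by simp
  ultimately show ?thesis using comb_shellable_laminar[OF _ lamE] W(1) by simp
qed


section \<open>Shedding vertices and minimal pendant sets\<close>

lemma Cx_eq_Pow:
  assumes "R \<subseteq> W" "\<And>T. T \<subseteq> W \<Longrightarrow> conn T \<Longrightarrow> card T \<le> r"
  shows "Cx r R W = Pow (W - R)"
proof -
  have "indep r (A \<union> R)" if "A \<subseteq> W - R" for A
  proof -
    have "A \<union> R \<subseteq> W" using that assms(1) by blast
    then show ?thesis using assms(2) unfolding indep_def by blast
  qed
  then show ?thesis unfolding Cx_def by blast
qed

text \<open>Adding a vertex of \<open>D - {u}\<close> to a face of the deletion creates no big set,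
  because big sets without \<open>u\<close> avoid \<open>D\<close>. So facets of the deletion
  contain \<open>D - {u}\<close>, and joining \<open>u\<close> would complete the big set
  \<open>D\<close>.\<close>

lemma comb_shellable_Cx_shed:
  assumes W: "finite W" "R \<subseteq> W" "u \<notin> R"
    and D: "D \<subseteq> W" "u \<in> D" "conn D" "r < card D" "R \<inter> D = {}"
    and big: "\<And>T. T \<subseteq> W - {u} \<Longrightarrow> conn T \<Longrightarrow> r < card T \<Longrightarrow> T \<inter> D = {}"
    and del: "comb_shellable (Cx r R (W - {u}))"
    and link: "comb_shellable (Cx r (insert u R) W)"
  shows "comb_shellable (Cx r R W)"
proof (rule comb_shellable_shed[where x = u])
  show "abstract_complex (Cx r R W)" using W(1) by (rule abstract_complex_Cx)
  have eq: "{A \<in> Cx r R W. u \<notin> A} = Cx r R (W - {u})" unfolding Cx_def by blast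
  then show "comb_shellable {A \<in> Cx r R W. u \<notin> A}" using del by simp
  have "u \<in> W" using D by blast
  then have "{A. u \<notin> A \<and> insert u A \<in> Cx r R W} = Cx r (insert u R) W"
    using W(3) unfolding Cx_def by auto
  then show "comb_shellable {A. u \<notin> A \<and> insert u A \<in> Cx r R W}" using link by simp
  fix F assume F: "F \<in> facets {A \<in> Cx r R W. u \<notin> A}"
  then have FC: "F \<in> Cx r R (W - {u})"
    and max: "\<And>F'. F' \<in> Cx r R (W - {u}) \<Longrightarrow> F \<subseteq> F' \<Longrightarrow> F' = F"
    unfolding facets_def eq by auto
  then have FW: "F \<subseteq> W - {u} - R" "indep r (F \<union> R)" unfolding Cx_def by simp_all
  have "v \<in> F" if v: "v \<in> D - {u}" for v
  proof -
    have "indep r (insert v F \<union> R)"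
      unfolding indep_def
    proof (intro allI impI, rule ccontr)
      fix T assume T: "T \<subseteq> insert v F \<union> R" "conn T" "\<not> card T \<le> r"
      then have "T \<subseteq> W - {u}" using FW(1) W(2,3) v D(1) by blast
      then have "T \<inter> D = {}" using T by (intro big) auto
      then have "T \<subseteq> F \<union> R" using T(1) v by blast
      then show False using FW(2) T(2,3) unfolding indep_def by blast
    qed
    moreover have "insert v F \<subseteq> W - {u} - R" using FW(1) v D(1,5) by blast
    ultimately have "insert v F \<in> Cx r R (W - {u})" unfolding Cx_def by simp
    then show ?thesis using max[of "insert v F"] by blast
  qed
  then have "D \<subseteq> insert u F \<union> R" by blast
  then have "\<not> indep r (insert u F \<union> R)" using D(3,4) unfolding indep_def by (meson leD)
  then show "insert u F \<notin> Cx r R W" unfolding Cx_def by simp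
qed

text \<open>The case without an outgoing edge makes a whole component pendant at any of its
  vertices, where the descent below can start.\<close>

definition pendant :: "'a set \<Rightarrow> 'a set \<Rightarrow> 'a \<Rightarrow> bool" where
  "pendant W D u \<longleftrightarrow> u \<in> D \<and> D \<subseteq> W \<and> (sep D (W - D) \<or>
     (\<exists>z\<in>W - D. adj u z \<and> (\<forall>x\<in>D. \<forall>y\<in>W - D. adj x y \<longrightarrow> x = u \<and> y = z)))"

lemma pendant_adj: "pendant W D u \<Longrightarrow> x \<in> D \<Longrightarrow> y \<in> W - D \<Longrightarrow> adj x y \<Longrightarrow> x = u"
  unfolding pendant_def separated_def by blast

text \<open>Descent on \<open>card C\<close>. A big \<open>T\<close> that avoids \<open>v\<close>
  but meets \<open>C\<close> stays in \<open>C\<close>, as edges leave \<open>C\<close> only at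
  \<open>v\<close>. The component of \<open>C - {v}\<close> around \<open>T\<close> has edges only
  to \<open>v\<close>, at most one by \<open>unique_neighbour\<close>, and is a smaller big pendant
  set.\<close>

lemma ex_minimal_pendant:
  assumes "finite W" "conn C" "pendant W C v" "r < card C"
  shows "\<exists>D u. pendant W D u \<and> D \<subseteq> C \<and> conn D \<and> r < card D \<and>
    (\<forall>T. T \<subseteq> W - {u} \<longrightarrow> conn T \<longrightarrow> r < card T \<longrightarrow> T \<inter> D = {})"
  using assms(2-4)
proof (induction "card C" arbitrary: C v rule: less_induct)
  case less
  have CW: "C \<subseteq> W" "v \<in> C" using less.prems unfolding pendant_def by simp_all
  have finC: "finite C" using CW(1) assms(1) finite_subset by blast
  show ?case
  proof (cases "\<exists>T. T \<subseteq> W - {v} \<and> conn T \<and> r < card T \<and> T \<inter> C \<noteq> {}")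
    case False
    then show ?thesis using less.prems by blast
  next
    case True
    then obtain T where T: "T \<subseteq> W - {v}" "conn T" "r < card T" "T \<inter> C \<noteq> {}" by blast
    have "sep (T \<inter> C) (T - C)"
      using T(1) pendant_adj[OF less.prems(2)] unfolding separated_def by blast
    then have "T \<subseteq> C" by (rule linked_subset_if_separated[OF T(2,4)])
    then have TC: "T \<subseteq> C - {v}" using T(1) by blast
    have "T \<noteq> {}" using T(4) by blast
    then obtain E where E: "T \<subseteq> E" "E \<subseteq> C - {v}" "conn E" "sep E (C - {v} - E)"
      using ex_component[OF _ TC T(2)] finC by blast
    have out: "y = v" if "x \<in> E" "y \<in> W - E" "adj x y" for x y
    proof -
      have "y \<in> C" using pendant_adj[OF less.prems(2), of x y] that E(2) by blast
      then show ?thesis using E(4) that unfolding separated_def by blast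
    qed
    have "\<exists>x. pendant W E x"
    proof (cases "\<exists>x\<in>E. adj x v")
      case True
      then obtain x where x: "x \<in> E" "adj x v" by blast
      have vE: "v \<notin> E" using E(2) by blast
      have "x' = x" if "x' \<in> E" "adj x' v" for x'
        using unique_neighbour[OF E(3) vE that(1) x(1) that(2) x(2)] .
      then have "\<forall>a\<in>E. \<forall>y\<in>W - E. adj a y \<longrightarrow> a = x \<and> y = v" using out by blast
      moreover have "v \<in> W - E" "E \<subseteq> W" using vE CW E(2) by auto
      ultimately have "pendant W E x" unfolding pendant_def using x by blast
      then show ?thesis by blast
    next
      case False
      then have "sep E (W - E)" using out unfolding separated_def by blast
      moreover obtain x where "x \<in> E" using E(1) \<open>T \<noteq> {}\<close> by blast
      moreover have "E \<subseteq> W" using CW E(2) by blast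
      ultimately show ?thesis unfolding pendant_def by blast
    qed
    then obtain x where x: "pendant W E x" by blast
    have EC: "E \<subset> C" using E(2) CW(2) by blast
    then have lt: "card E < card C" using finC by (rule psubset_card_mono[rotated])
    have finE: "finite E" using EC finC finite_subset by blast
    have "r < card E" using T(3) card_mono[OF finE E(1)] by simp
    from less.hyps[OF lt E(3) x this] obtain D u where "pendant W D u" "D \<subseteq> E" "conn D" "r < card D"
      "\<forall>T. T \<subseteq> W - {u} \<longrightarrow> conn T \<longrightarrow> r < card T \<longrightarrow> T \<inter> D = {}" by blast
    moreover then have "D \<subseteq> C" using EC by blast
    ultimately show ?thesis by blast
  qed
qed

lemma component_pendant:
  assumes "C \<subseteq> W" "sep C (W - C)" "u \<in> C"
  shows "pendant W C u"
  using assms unfolding pendant_def by simp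

section \<open>The case \<open>r = 1\<close>\<close>

lemma comb_shellable_Cx_1:
  assumes "finite W"
  shows "comb_shellable (Cx 1 {} W)"
  using assms
proof (induction "card W" arbitrary: W rule: less_induct)
  case less
  have IH: "comb_shellable (Cx 1 {} V)" if "V \<subseteq> W" "u \<in> W" "u \<notin> V" for V u
  proof (rule less.hyps)
    show "card V < card W" using that less.prems by (intro psubset_card_mono) auto
    show "finite V" using that less.prems finite_subset by blast
  qed
  show ?case
  proof (cases "\<exists>T\<subseteq>W. conn T \<and> 1 < card T")
    case False
    then have "Cx 1 {} W = Pow (W - {})" by (intro Cx_eq_Pow) auto
    then show ?thesis using comb_shellable_Pow less.prems by simp
  next
    case True
    then obtain T where T: "T \<subseteq> W" "conn T" "1 < card T" by blast
    then have "T \<noteq> {}" by auto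
    then obtain C where C: "T \<subseteq> C" "C \<subseteq> W" "conn C" "sep C (W - C)"
      using ex_component[OF less.prems T(1,2)] by blast
    obtain v where "v \<in> C" using \<open>T \<noteq> {}\<close> C(1) by blast
    have "1 < card C"
      using T(3) card_mono[OF finite_subset[OF C(2) less.prems] C(1)] by simp
    then obtain D u where D: "pendant W D u" "D \<subseteq> C" "conn D" "1 < card D"
      "\<forall>T. T \<subseteq> W - {u} \<longrightarrow> conn T \<longrightarrow> 1 < card T \<longrightarrow> T \<inter> D = {}"
      using ex_minimal_pendant[OF less.prems C(3) component_pendant[OF C(2,4) \<open>v \<in> C\<close>]] by blast
    have uD: "u \<in> D" "D \<subseteq> W" using D(1) unfolding pendant_def by simp_all
    \<comment> \<open>A face through \<open>u\<close> is an independent set avoiding the neighbours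
      of \<open>u\<close>, so the link is the complex of a smaller forest and falls under the
      induction.\<close>
    let ?N = "insert u {v. adj u v}"
    have "indep 1 (insert u A) \<longleftrightarrow> A \<inter> {v. adj u v} = {} \<and> indep 1 A" for A
    proof
      assume ind: "indep 1 (insert u A)"
      have "\<not> adj u v" if "v \<in> A" for v
      proof
        assume a: "adj u v"
        then have "conn {v, u}" using conn_insert[OF conn_singleton[of u]] by simp
        moreover have "v \<noteq> u" using a adj_irrefl by blast
        moreover have "{v, u} \<subseteq> insert u A" using that by blast
        ultimately have "card {v, u} \<le> 1" "v \<noteq> u" using ind unfolding indep_def by blast+
        then show False by simp
      qed
      then show "A \<inter> {v. adj u v} = {} \<and> indep 1 A" using ind indep_mono by blast
    next
      assume *: "A \<inter> {v. adj u v} = {} \<and> indep 1 A"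
      show "indep 1 (insert u A)"
        unfolding indep_def
      proof (intro allI impI)
        fix T assume T: "T \<subseteq> insert u A" "conn T"
        show "card T \<le> 1"
        proof (cases "u \<in> T")
          case True
          have "sep (T \<inter> {u}) (T - {u})" using T(1) * unfolding separated_def by blast
          then have "T \<subseteq> {u}" using linked_subset_if_separated[OF T(2), of "{u}"] True by blast
          then have "card T \<le> card {u}" by (intro card_mono) auto
          then show ?thesis by simp
        next
          case False
          then have "T \<subseteq> A" using T(1) by blast
          then show ?thesis using * T(2) unfolding indep_def by blast
        qed
      qed
    qed
    then have "Cx 1 {u} W = Cx 1 {} (W - ?N)" unfolding Cx_def by auto
    moreover have "comb_shellable (Cx 1 {} (W - ?N))" using IH[of "W - ?N" u] uD by blast
    ultimately have link: "comb_shellable (Cx 1 {u} W)" by simp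
    show ?thesis
    proof (rule comb_shellable_Cx_shed[where u = u and D = D])
      show "comb_shellable (Cx 1 {} (W - {u}))" using IH[of "W - {u}" u] uD by blast
    qed (use less.prems D uD link in auto)
  qed
qed

section \<open>The case \<open>r \<ge> 2\<close>\<close>

text \<open>Two blocks \<^term>\<open>D\<close> and \<^term>\<open>T0\<close> of three vertices joined through \<^term>\<open>z\<close>: the only
  configuration in which the big connected sets are hit neither by a clique alone nor by a clique and
  a separate component.\<close>

lemma comb_shellable_Cx_two_blocks:
  assumes W: "finite W" "W = insert z (D \<union> T0)" "z \<notin> D" "z \<notin> T0" "D \<inter> T0 = {}"
    and D: "conn D" "card D = 3" "u \<in> D" "adj u z"
    and T0: "conn T0" "card T0 = 3" "w \<in> T0" "adj z w"
    and sepDT: "sep D T0"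
    and bigD: "\<And>T. T \<subseteq> W - {u} \<Longrightarrow> conn T \<Longrightarrow> 2 < card T \<Longrightarrow> T \<inter> D = {}"
  shows "comb_shellable (Cx 2 {u} W)"
proof -
  have fin: "finite D" "finite T0" using W(1,2) by auto
  have uw: "u \<noteq> w" "u \<notin> T0" "w \<notin> D" "u \<noteq> z" "w \<noteq> z" using W(3-5) D(3) T0(3) by auto
  have sepTD: "sep T0 D" using sepDT by (rule sep_sym)
  have Tz: "x = w" if "x \<in> T0" "adj x z" for x
    using unique_neighbour[OF T0(1) W(4) that(1) T0(3) that(2) adj_sym[OF T0(4)]] .
  \<comment> \<open>Edges leave \<open>T0\<close> only at \<open>w\<close>, and
    \<open>T0 - {w}\<close> has just two vertices.\<close>
  have bigT: "T \<inter> T0 = {}" if T: "T \<subseteq> W - {w}" "conn T" "2 < card T" for T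
  proof (rule ccontr)
    assume ne: "T \<inter> T0 \<noteq> {}"
    have "\<not> adj x y" if "x \<in> T \<inter> T0" "y \<in> T - T0" for x y
    proof
      assume a: "adj x y"
      have "y \<in> D \<or> y = z" using that(2) T(1) W(2) by blast
      then show False
      proof
        assume "y \<in> D"
        then show False using sepTD that(1) a unfolding separated_def by blast
      next
        assume "y = z"
        then show False using Tz[of x] that(1) a T(1) by blast
      qed
    qed
    then have "sep (T \<inter> T0) (T - T0)" unfolding separated_def by blast
    then have "T \<subseteq> T0" by (rule linked_subset_if_separated[OF T(2) ne])
    then have "T \<subset> T0" using T(1) T0(3) by blast
    then have "card T < card T0" by (rule psubset_card_mono[OF fin(2)])
    then show False using T(3) T0(2) by simp
  qed
  have not_z: "\<not> T \<subseteq> {z}" if "2 < card T" for T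
    using that card_mono[of "{z}" T] by auto
  show ?thesis
  proof (rule comb_shellable_Cx_shed[where u = w and D = T0])
    show "T \<inter> T0 = {}" if "T \<subseteq> W - {w}" "conn T" "2 < card T" for T
      using that by (rule bigT)
    \<comment> \<open>With \<open>w\<close> deleted, a big set without \<open>u\<close> would avoid
      \<open>D\<close> and \<open>T0\<close> and fit into \<open>{z}\<close>; so all big sets
      contain \<open>u\<close>.\<close>
    show "comb_shellable (Cx 2 {u} (W - {w}))"
    proof (rule comb_shellable_Cx_if_hit[where C = "insert z D" and K = "{u}" and ?C1.0 = "{}"])
      show "conn (insert z D)" using conn_insert[OF D(1,3,4)] .
      have "\<not> adj x y" if "x \<in> insert z D" "y \<in> W - {w} - insert z D" for x y
      proof
        assume a: "adj x y"
        have y: "y \<in> T0" "y \<noteq> w" using that(2) W(2) by auto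
        then have "x \<noteq> z" using Tz[of y] a adj_sym by blast
        then show False using that(1) y(1) a sepDT unfolding separated_def by blast
      qed
      then show "sep (insert z D) (W - {w} - insert z D)" unfolding separated_def by blast
      show "T \<inter> ({u} \<union> {}) \<noteq> {}" if T: "T \<subseteq> W - {w}" "conn T" "2 < card T" for T
      proof
        assume "T \<inter> ({u} \<union> {}) = {}"
        then have "T \<inter> D = {}" using T by (intro bigD) auto
        then have "T \<subseteq> {z}" using bigT[OF T] T(1) W(2) by blast
        then show False using not_z T(3) by blast
      qed
    qed (use W uw D(3) in \<open>auto simp: linked_def separated_def\<close>)
    \<comment> \<open>In the link of \<open>u\<close> and \<open>w\<close>, the sets
      \<open>D\<close>, \<open>T0\<close> and \<open>{u, z, w}\<close> must lose a vertex; the last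
      can only lose \<open>z\<close>. These demands say that the blocks \<open>D\<close>,
      \<open>T0\<close>, \<open>{z}\<close> indexed by the removed vertices cover
      \<open>W\<close>.\<close>
    define E where "E v = (if v \<in> D then D else if v \<in> T0 then T0 else {z})" for v
    have E: "E v = D \<or> E v = T0 \<or> E v = {z}" for v unfolding E_def by simp
    have "E u' \<subseteq> E v \<or> E v \<subseteq> E u' \<or> E u' \<inter> E v = {}" for u' v
    proof (cases "E u' = E v")
      case False
      then have "E u' \<inter> E v = {}" using E[of u'] E[of v] W(3-5) by auto
      then show ?thesis by simp
    qed simp
    then have lam: "laminar (W - {w, u}) E" unfolding laminar_def by blast
    have "indep 2 (A \<union> {w, u}) \<longleftrightarrow> card W \<le> card (\<Union>(E ` (W - {w, u} - A)))"
      if A: "A \<subseteq> W - {w, u}" for A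
    proof -
      define S where "S = W - {w, u} - A"
      have "indep 2 (A \<union> {w, u}) \<longleftrightarrow> S \<inter> D \<noteq> {} \<and> S \<inter> T0 \<noteq> {} \<and> z \<in> S"
      proof (intro iffI conjI)
        assume ind: "indep 2 (A \<union> {w, u})"
        have small: "\<not> T \<subseteq> A \<union> {w, u}" if "conn T" "card T = 3" for T
        proof
          assume "T \<subseteq> A \<union> {w, u}"
          then have "card T \<le> 2" using ind that(1) unfolding indep_def by blast
          then show False using that(2) by simp
        qed
        show "S \<inter> D \<noteq> {}" using small[OF D(1,2)] W(2) unfolding S_def by auto
        show "S \<inter> T0 \<noteq> {}" using small[OF T0(1,2)] W(2) unfolding S_def by auto
        have "conn (insert w (insert z {u}))"
          by (rule conn_insert[of _ z], rule conn_insert[of _ u]) (use conn_singleton D(4) T0(4) in auto)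
        moreover have "card (insert w (insert z {u})) = 3" using uw by auto
        ultimately have "\<not> insert w (insert z {u}) \<subseteq> A \<union> {w, u}" by (rule small)
        then show "z \<in> S" using W(2) uw unfolding S_def by auto
      next
        assume S: "S \<inter> D \<noteq> {} \<and> S \<inter> T0 \<noteq> {} \<and> z \<in> S"
        show "indep 2 (A \<union> {w, u})"
          unfolding indep_def
        proof (intro allI impI, rule ccontr)
          fix T assume T: "T \<subseteq> A \<union> {w, u}" "conn T" "\<not> card T \<le> 2"
          have TW: "T \<subseteq> D \<union> T0" using T(1) A S W(2) D(3) T0(3) unfolding S_def by blast
          have TS: "T \<inter> S = {}" using T(1) unfolding S_def by blast
          have block: "\<not> T \<subseteq> B" if "card B = 3" "finite B" "S \<inter> B \<noteq> {}" for B
          proof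
            assume "T \<subseteq> B"
            then have "T \<subset> B" using that(3) TS by blast
            then have "card T < card B" by (rule psubset_card_mono[OF that(2)])
            then show False using that(1) T(3) by simp
          qed
          have "\<not> T \<subseteq> T0" using block[OF T0(2) fin(2)] S by blast
          then have ne: "T \<inter> D \<noteq> {}" using TW by blast
          have "sep (T \<inter> D) (T - D)" by (rule separated_mono[OF sepDT]) (use TW in auto)
          then have "T \<subseteq> D" by (rule linked_subset_if_separated[OF T(2) ne])
          then show False using block[OF D(2) fin(1)] S by blast
        qed
      qed
      also have "\<dots> \<longleftrightarrow> \<Union>(E ` S) = W"
      proof
        assume S: "S \<inter> D \<noteq> {} \<and> S \<inter> T0 \<noteq> {} \<and> z \<in> S"
        then obtain d t where "d \<in> S" "d \<in> D" "t \<in> S" "t \<in> T0" by blast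
        moreover have "E d = D" "E t = T0" "E z = {z}"
          using calculation W(3-5) unfolding E_def by auto
        ultimately have "D \<subseteq> \<Union>(E ` S)" "T0 \<subseteq> \<Union>(E ` S)" "z \<in> \<Union>(E ` S)"
          using S by blast+
        moreover have "E v \<subseteq> W" for v using E[of v] W(2) by auto
        then have "\<Union>(E ` S) \<subseteq> W" by blast
        ultimately show "\<Union>(E ` S) = W" unfolding W(2) by blast
      next
        assume eq: "\<Union>(E ` S) = W"
        have SW: "S \<subseteq> insert z (D \<union> T0)" unfolding S_def W(2) by blast
        have "u \<in> \<Union>(E ` S)" "w \<in> \<Union>(E ` S)" "z \<in> \<Union>(E ` S)"
          unfolding eq W(2) using D(3) T0(3) by simp_all
        then obtain a b c where abc: "a \<in> S" "u \<in> E a" "b \<in> S" "w \<in> E b" "c \<in> S" "z \<in> E c"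
          by (elim UN_E)
        have "a \<in> D" using abc(2) uw unfolding E_def by (simp split: if_splits)
        moreover have "b \<in> T0" using abc(4) uw unfolding E_def by (simp split: if_splits)
        moreover have "c = z" using abc(5,6) SW W(3,4) unfolding E_def by (auto split: if_splits)
        ultimately show "S \<inter> D \<noteq> {} \<and> S \<inter> T0 \<noteq> {} \<and> z \<in> S" using abc(1,3,5) by blast
      qed
      also have "\<dots> \<longleftrightarrow> card W \<le> card (\<Union>(E ` S))"
      proof
        assume "card W \<le> card (\<Union>(E ` S))"
        moreover have "E v \<subseteq> W" for v using E[of v] W(2) by auto
        then have "\<Union>(E ` S) \<subseteq> W" by blast
        ultimately show "\<Union>(E ` S) = W" using card_seteq[OF W(1)] by blast
      qed simp
      finally show ?thesis unfolding S_def .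
    qed
    then have "Cx 2 {w, u} W =
        {A. A \<subseteq> W - {w, u} \<and> card W \<le> card (\<Union>(E ` (W - {w, u} - A)))}"
      unfolding Cx_def by blast
    moreover have "finite (E v)" for v unfolding E_def using fin by simp
    ultimately show "comb_shellable (Cx 2 (insert w {u}) W)"
      using comb_shellable_laminar[OF _ lam] W(1) by simp
  qed (use W D T0 uw in auto)
qed

text \<open>If every big set contains \<open>u\<close>, the clique \<open>{u}\<close> suffices. If
  \<open>D\<close> is a component, the other big set is a component with \<open>r + 1\<close>
  vertices. If \<open>D\<close> hangs on the edge from \<open>u\<close> to \<open>z\<close>, the
  clique is \<open>{u, z}\<close>, and a big set missing it forces \<open>r = 2\<close> and seven
  vertices.\<close>

lemma comb_shellable_Cx_link:
  assumes W: "finite W" "2 \<le> r" "card W \<le> r + 5"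
    and C: "conn C" "C \<subseteq> W" "sep C (W - C)" "\<And>T. T \<subseteq> W \<Longrightarrow> conn T \<Longrightarrow> card T \<le> card C"
    and D: "pendant W D u" "D \<subseteq> C" "conn D" "r < card D"
    and big: "\<And>T. T \<subseteq> W - {u} \<Longrightarrow> conn T \<Longrightarrow> r < card T \<Longrightarrow> T \<inter> D = {}"
  shows "comb_shellable (Cx r {u} W)"
proof -
  have uD: "u \<in> D" "D \<subseteq> W" "u \<in> W" using D(1) unfolding pendant_def by auto
  have uC: "u \<in> C" using uD D(2) by blast
  have fin: "finite X" if "X \<subseteq> W" for X using that W(1) finite_subset by blast
  have conn0: "conn {}" "sep {} X" for X unfolding linked_def separated_def by auto
  consider (u) "\<And>T. T \<subseteq> W \<Longrightarrow> conn T \<Longrightarrow> r < card T \<Longrightarrow> u \<in> T"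
    | (isolated) T0 where "sep D (W - D)" "T0 \<subseteq> W" "conn T0" "r < card T0" "u \<notin> T0"
    | (z) z where "z \<in> W - D" "adj u z" "\<And>x y. x \<in> D \<Longrightarrow> y \<in> W - D \<Longrightarrow> adj x y \<Longrightarrow> x = u \<and> y = z"
    using D(1) unfolding pendant_def by blast
  then show ?thesis
  proof cases
    case u
    show ?thesis
      by (rule comb_shellable_Cx_if_hit[where C = C and K = "{u}" and ?C1.0 = "{}"])
        (use W C uC uD u conn0 in auto)
  next
    case isolated
    have "D = C"
    proof
      show "C \<subseteq> D"
        using conn_subset_component[OF C(1,2) isolated(1)] uD(1) uC by blast
    qed (rule D(2))
    have "T0 \<noteq> {}" using isolated(4) by auto
    then obtain C1 where C1: "T0 \<subseteq> C1" "C1 \<subseteq> W" "conn C1" "sep C1 (W - C1)"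
      using ex_component[OF W(1) isolated(2,3)] by blast
    have "T0 \<inter> D = {}" using isolated(2-5) by (intro big) auto
    then have C1D: "C1 \<inter> D = {}"
      using conn_subset_component[OF C1(3,2) isolated(1)] C1(1) \<open>T0 \<noteq> {}\<close> by blast
    have "card T0 \<le> card C1" using C1(1) fin[OF C1(2)] by (rule card_mono[rotated])
    moreover have "card C1 \<le> card D" using C(4)[OF C1(2,3)] \<open>D = C\<close> by simp
    moreover have "card C1 + card D = card (C1 \<union> D)"
      using C1D fin C1(2) uD(2) by (simp add: card_Un_disjoint)
    moreover have "card (C1 \<union> D) \<le> card W" using W(1) C1(2) uD(2) by (intro card_mono) auto
    \<comment> \<open>Maximality of \<open>C\<close> gives \<open>2 * card C1 \<le> r + 5\<close>,
      which for \<open>r \<ge> 2\<close> leaves only \<open>r + 1\<close>.\<close>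
    ultimately have card: "card C1 = r + 1" using W(2,3) isolated(4) by linarith
    \<comment> \<open>Three disjoint big sets would need \<open>3 * (r + 1) > r + 5\<close>
      vertices.\<close>
    have hit: "T \<inter> ({u} \<union> C1) \<noteq> {}" if T: "T \<subseteq> W" "conn T" "r < card T" for T
    proof
      assume *: "T \<inter> ({u} \<union> C1) = {}"
      then have "T \<inter> D = {}" using T by (intro big) auto
      then have "card (T \<union> (C1 \<union> D)) = card T + card (C1 \<union> D)"
        using * fin T(1) C1(2) uD(2) by (intro card_Un_disjoint) auto
      moreover have "card (T \<union> (C1 \<union> D)) \<le> card W"
        using W(1) T(1) C1(2) uD(2) by (intro card_mono) auto
      ultimately show False
        using T(3) card D(4) W(2,3) \<open>card C1 + card D = card (C1 \<union> D)\<close> by linarith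
    qed
    show ?thesis
      by (rule comb_shellable_Cx_if_hit[where C = C and K = "{u}" and ?C1.0 = C1])
        (use W C uC uD C1 C1D card hit \<open>D = C\<close> in auto)
  next
    case z
    have "z \<in> C" using C(3) uC z(1,2) unfolding separated_def by blast
    have uz: "u \<noteq> z" using uD z(1) by blast
    have edge: "adj a b" if "a \<in> {u, z}" "b \<in> {u, z}" "a \<noteq> b" for a b
      using that z(2) adj_sym[OF z(2)] by auto
    show ?thesis
    proof (cases "\<exists>T\<subseteq>W. conn T \<and> r < card T \<and> u \<notin> T \<and> z \<notin> T")
      case False
      then have hit: "T \<inter> ({u, z} \<union> {}) \<noteq> {}" if "T \<subseteq> W" "conn T" "r < card T" for T
        using that by blast
      show ?thesis
        by (rule comb_shellable_Cx_if_hit[where C = C and K = "{u, z}" and ?C1.0 = "{}"])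
          (use W C uC uD \<open>z \<in> C\<close> edge hit conn0 in auto)
    next
      case True
      then obtain T0 where T0: "T0 \<subseteq> W" "conn T0" "r < card T0" "u \<notin> T0" "z \<notin> T0" by blast
      have rest: "T \<subseteq> W - D - {z}" if "T \<subseteq> W" "conn T" "r < card T" "u \<notin> T" "z \<notin> T" for T
      proof -
        have "T \<inter> D = {}" using that by (intro big) auto
        then show ?thesis using that by blast
      qed
      have cW: "card W = card (W - D - {z}) + 1 + card D"
      proof -
        have "card W = card (W - D) + card D"
          using card_Diff_subset[OF fin[OF uD(2)] uD(2)] card_mono[OF W(1) uD(2)] by simp
        moreover have "card (W - D) = card (W - D - {z}) + 1"
          using card_Suc_Diff1[of "W - D" z] z(1) W(1) by simp
        ultimately show ?thesis by simp
      qed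
      have finr: "finite (W - D - {z})" using W(1) by simp
      have T0r: "T0 \<subseteq> W - D - {z}" using rest T0 by blast
      have le: "card T0 \<le> card (W - D - {z})" using card_mono[OF finr T0r] .
      \<comment> \<open>At most \<open>r + 5 - (r + 1) - 1 = 3\<close> vertices lie outside
        \<open>D\<close> and \<open>z\<close>, while \<open>T0\<close> has at least
        \<open>r + 1 \<ge> 3\<close>, so all bounds are attained.\<close>
      have r: "r = 2" and cards: "card (W - D - {z}) = 3" "card T0 = 3" "card D = 3"
        using cW le T0(3) D(4) W(2,3) by linarith+
      have T0eq: "T0 = W - D - {z}" using card_seteq[OF finr T0r] cards by simp
      have disj: "T0 \<inter> D = {}" using T0eq by blast
      have sepDT: "sep D T0" using z(3) T0r unfolding separated_def by blast
      \<comment> \<open>Without an edge to \<open>z\<close>, the set \<open>T0\<close> is a separate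
        component and serves as \<open>C1\<close>; otherwise the two blocks are joined through
        \<open>z\<close>.\<close>
      show ?thesis
      proof (cases "sep T0 {z}")
        case True
        then have "sep T0 (W - T0)"
          using sep_sym[OF sepDT] z(1) unfolding T0eq separated_def by blast
        moreover have "T0 \<inter> C = {}"
          using conn_subset_component[OF C(1,2) calculation] uC T0(4) by blast
        moreover have "T \<inter> ({u, z} \<union> T0) \<noteq> {}" if "T \<subseteq> W" "conn T" "r < card T" for T
        proof -
          have "T \<noteq> {}" using that(3) by auto
          then show ?thesis using rest[OF that] unfolding T0eq by blast
        qed
        ultimately show ?thesis
          by (intro comb_shellable_Cx_if_hit[where C = C and K = "{u, z}" and ?C1.0 = T0])
            (use W C uC uD \<open>z \<in> C\<close> edge T0 cards r in auto)
      next
        case False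
        then obtain w where w: "w \<in> T0" "adj w z" unfolding separated_def by blast
        have Weq: "W = insert z (D \<union> T0)" using T0eq z(1) uD(2) by blast
        have "D \<inter> T0 = {}" "z \<notin> D" using disj z(1) by blast+
        then show ?thesis
          using comb_shellable_Cx_two_blocks[OF W(1) Weq _ T0(5) _ D(3) cards(3) uD(1) z(2) T0(2)
              cards(2) w(1) adj_sym[OF w(2)] sepDT] big unfolding r by simp
      qed
    qed
  qed
qed

lemma comb_shellable_Cx:
  assumes "finite W" "2 \<le> r" "card W \<le> r + 5"
  shows "comb_shellable (Cx r {} W)"
  using assms
proof (induction "card W" arbitrary: W rule: less_induct)
  case less
  show ?case
  proof (cases "\<exists>T\<subseteq>W. conn T \<and> r < card T")
    case False
    then have "Cx r {} W = Pow (W - {})" by (intro Cx_eq_Pow) auto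
    then show ?thesis using comb_shellable_Pow less.prems by simp
  next
    case True
    \<comment> \<open>The pendant set is sought inside a largest connected set, because the analysis
      of the link compares component sizes.\<close>
    define S where "S = {T. T \<subseteq> W \<and> conn T}"
    have S: "finite S" "S \<noteq> {}" using True less.prems(1) unfolding S_def by auto
    then have "Max (card ` S) \<in> card ` S" by (intro Max_in) auto
    then obtain C where "C \<in> S" "card C = Max (card ` S)" by auto
    then have C: "C \<subseteq> W" "conn C" and max: "\<And>T. T \<subseteq> W \<Longrightarrow> conn T \<Longrightarrow> card T \<le> card C"
      using S(1) unfolding S_def by auto
    have big: "r < card C" using True max less_le_trans by blast
    have "\<not> adj x y" if "x \<in> C" "y \<in> W - C" for x y
    proof
      assume "adj x y"
      then have "conn (insert y C)" using conn_insert C(2) that by blast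
      then have "card (insert y C) \<le> card C" using C(1) that by (intro max) auto
      then show False using that finite_subset[OF C(1) less.prems(1)] by simp
    qed
    then have sepC: "sep C (W - C)" unfolding separated_def by blast
    obtain v where "v \<in> C" using big by fastforce
    then have pen: "pendant W C v" using component_pendant[OF C(1) sepC] by blast
    obtain D u where D: "pendant W D u" "D \<subseteq> C" "conn D" "r < card D"
      and hit: "\<And>T. T \<subseteq> W - {u} \<Longrightarrow> conn T \<Longrightarrow> r < card T \<Longrightarrow> T \<inter> D = {}"
      using ex_minimal_pendant[OF less.prems(1) C(2) pen big] by blast
    have uD: "u \<in> D" "D \<subseteq> W" "u \<in> W" using D(1) unfolding pendant_def by auto
    have "card (W - {u}) < card W" using uD(3) less.prems(1) by (meson card_Diff1_less)
    then have del: "comb_shellable (Cx r {} (W - {u}))"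
      using less.prems by (intro less.hyps) auto
    have link: "comb_shellable (Cx r {u} W)"
      using less.prems C(2,1) sepC max D hit by (rule comb_shellable_Cx_link)
    show ?thesis
      by (rule comb_shellable_Cx_shed[OF less.prems(1) _ _ uD(2,1) D(3,4) _ hit del link]) auto
  qed
qed

end
section \<open>Forests as symmetric digraphs\<close>

context sym_digraph
begin

text \<open>What is reachable from \<open>a\<close> inside \<open>X\<close> has no edge to the rest
  of \<open>X\<close>, so it is all of \<open>X\<close>.\<close>

lemma reachable_induce_if_linked:
  assumes "linked (dominates G) X" "a \<in> X" "b \<in> X"
  shows "a \<rightarrow>\<^sup>*\<^bsub>G \<restriction> X\<^esub> b"
proof -
  interpret H: wf_digraph "G \<restriction> X" by (rule wellformed_induce_subgraph)
  define Y where "Y = {y. a \<rightarrow>\<^sup>*\<^bsub>G \<restriction> X\<^esub> y}"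
  have "\<not> x \<rightarrow>\<^bsub>G\<^esub> y" if "x \<in> X \<inter> Y" "y \<in> X - Y" for x y
  proof
    assume "x \<rightarrow>\<^bsub>G\<^esub> y"
    then have "x \<rightarrow>\<^bsub>G \<restriction> X\<^esub> y" using that by (auto simp: arcs_ends_conv)
    then show False using that H.reachable_adj_trans unfolding Y_def by blast
  qed
  then have sep: "separated (dominates G) (X \<inter> Y) (X - Y)" unfolding separated_def by blast
  have "a \<in> X \<inter> Y" using assms(2) unfolding Y_def by simp
  then have "X \<subseteq> Y" using linked_subset_if_separated[OF assms(1) _ sep] by blast
  then show ?thesis using assms(3) unfolding Y_def by blast
qed

text \<open>A path starting in a part \<open>Y\<close> of the component cannot leave
  \<open>Y\<close> if no edge leads from \<open>Y\<close> to \<open>S - Y\<close>.\<close>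

lemma linked_scc:
  assumes "A \<subseteq> verts G" "S \<in> pre_digraph.sccs_verts (G \<restriction> A)"
  shows "S \<subseteq> A" "linked (dominates G) S"
proof -
  interpret H: sym_digraph "G \<restriction> A"
    using assms(1) by (intro induced_graph_imp_graph induced_induce)
  have S: "\<And>u v. u \<in> S \<Longrightarrow> v \<in> S \<Longrightarrow> u \<rightarrow>\<^sup>*\<^bsub>G \<restriction> A\<^esub> v"
    "\<And>u v. u \<in> S \<Longrightarrow> u \<rightarrow>\<^sup>*\<^bsub>G \<restriction> A\<^esub> v \<Longrightarrow> v \<in> S"
    using assms(2) H.symmetric_reachable' unfolding H.in_sccs_verts_conv_reachable by blast+
  show "S \<subseteq> A" using S(1) H.reachable_in_verts by fastforce
  show "linked (dominates G) S"
  proof (rule linkedI, rule ccontr)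
    fix Y assume Y: "Y \<subset> S" "Y \<noteq> {}" and no: "\<not> (\<exists>y\<in>Y. \<exists>x\<in>S - Y. y \<rightarrow>\<^bsub>G\<^esub> x)"
    obtain y x where yx: "y \<in> Y" "x \<in> S" "x \<notin> Y" using Y by blast
    then have "y \<rightarrow>\<^sup>*\<^bsub>G \<restriction> A\<^esub> x" using S(1) Y(1) by blast
    then have "x \<in> Y"
    proof (induction rule: H.reachable_induct)
      case (step v w)
      then have "w \<in> S" using S(2) H.reachable_adj_trans yx(1) Y(1) by blast
      then show ?case using no step(3) dominates_induce_subgraphD[OF step(2)] by blast
    qed (rule yx(1))
    then show False using yx(3) by blast
  qed
qed

text \<open>Components are linked and each nonempty linked subset lies in one, so bounding
  components bounds all linked subsets.\<close>

lemma r_independent_iff_linked: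
  assumes "finite (verts G)"
  shows "r_independent G r A \<longleftrightarrow>
    A \<subseteq> verts G \<and> (\<forall>T\<subseteq>A. linked (dominates G) T \<longrightarrow> card T \<le> r)"
proof (cases "A \<subseteq> verts G")
  case True
  interpret H: sym_digraph "G \<restriction> A"
    using True by (intro induced_graph_imp_graph induced_induce)
  have "\<exists>S\<in>H.sccs_verts. T \<subseteq> S" if T: "T \<subseteq> A" "linked (dominates G) T" "x \<in> T" for T x
  proof
    have "x \<in> verts (G \<restriction> A)" using T by auto
    then show "H.scc_of x \<in> H.sccs_verts" by (rule H.scc_of_in_sccs_verts)
    have "x \<rightarrow>\<^sup>*\<^bsub>G \<restriction> A\<^esub> y" if "y \<in> T" for y
      using reachable_induce_ss[OF reachable_induce_if_linked[OF T(2,3) that] T(1)] .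
    then show "T \<subseteq> H.scc_of x" using H.symmetric_reachable' unfolding H.scc_of_def by blast
  qed
  note ex_scc = this
  have fin: "finite A" using True assms finite_subset by blast
  have "(\<forall>S\<in>H.sccs_verts. card S \<le> r) \<longleftrightarrow> (\<forall>T\<subseteq>A. linked (dominates G) T \<longrightarrow> card T \<le> r)"
  proof (intro iffI allI impI ballI)
    fix T assume *: "\<forall>S\<in>H.sccs_verts. card S \<le> r" and T: "T \<subseteq> A" "linked (dominates G) T"
    show "card T \<le> r"
    proof (cases "T = {}")
      case False
      then obtain S where S: "S \<in> H.sccs_verts" "T \<subseteq> S" using ex_scc[OF T] by blast
      then have "finite S" using linked_scc(1)[OF True] fin finite_subset by blast
      then have "card T \<le> card S" using S(2) by (rule card_mono)
      then show ?thesis using * S(1) by fastforce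
    qed simp
  next
    fix S assume "\<forall>T\<subseteq>A. linked (dominates G) T \<longrightarrow> card T \<le> r" "S \<in> H.sccs_verts"
    then show "card S \<le> r" using linked_scc[OF True] by blast
  qed
  then show ?thesis using True unfolding r_independent_def by simp
qed (simp add: r_independent_def)

end

text \<open>A path inside \<open>X\<close> between two neighbours \<open>a\<close> and
  \<open>b\<close> of \<open>v\<close>, closed up through \<open>v\<close>, is a cycle with at least
  three arcs.\<close>

lemma forest_adj_if_forest_graph:
  assumes "forest_graph G"
  shows "forest_adj (dominates G)"
proof -
  interpret graph G using assms unfolding forest_graph_def by blast
  have no_cycle: "\<And>p. cycle p \<Longrightarrow> length p < 3"
    using assms unfolding forest_graph_def by (meson not_le)
  show ?thesis
  proof
    show "v \<rightarrow>\<^bsub>G\<^esub> u" if "u \<rightarrow>\<^bsub>G\<^esub> v" for u v using that sym_arcs unfolding symmetric_def by (rule symD[rotated])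
    show "\<not> v \<rightarrow>\<^bsub>G\<^esub> v" for v using adj_not_same by blast
    fix X v a b
    assume X: "linked (dominates G) X" and v: "v \<notin> X" and ab: "a \<in> X" "b \<in> X" and av: "a \<rightarrow>\<^bsub>G\<^esub> v" "b \<rightarrow>\<^bsub>G\<^esub> v"
    show "a = b"
    proof (rule ccontr)
      assume ne: "a \<noteq> b"
      \<comment> \<open>\<open>linked\<close> alone does not place \<open>X\<close> among the
        vertices; here \<open>X\<close> has two elements, so each of its members has a
        neighbour.\<close>
      have XV: "X \<subseteq> verts G"
      proof
        fix x assume "x \<in> X"
        moreover then have "{x} \<subset> X" using ab ne by blast
        ultimately obtain y where "x \<rightarrow>\<^bsub>G\<^esub> y" using linkedD[OF X, of "{x}"] by blast
        then show "x \<in> verts G" by (rule adj_in_verts)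
      qed
      interpret H: wf_digraph "G \<restriction> X" by (rule wellformed_induce_subgraph)
      obtain p where p: "H.apath a p b"
        using reachable_induce_if_linked[OF X ab] H.reachable_apath by blast
      then have pH: "H.awalk a p b" and dist: "distinct (awalk_verts a p)"
        unfolding H.apath_def awalk_verts_induce by simp_all
      have "set p \<subseteq> arcs (G \<restriction> X)" using pH unfolding H.awalk_def by blast
      moreover have "a \<in> verts (G \<restriction> X)" using ab(1) by simp
      ultimately have "set (awalk_verts a p) \<subseteq> verts (G \<restriction> X)"
        using H.awalk_verts_in_verts[of a p, unfolded awalk_verts_induce] by blast
      then have pX: "set (awalk_verts a p) \<subseteq> X" by simp
      have walk: "awalk a p b"
        using pH subgraph_awalk_imp_awalk[OF _ subgraph_induce_subgraphI[OF XV]] by blast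
      have "v \<rightarrow>\<^bsub>G\<^esub> a" using av(1) sym_arcs unfolding symmetric_def by (rule symD[rotated])
      then obtain e where e: "e \<in> arcs G" "tail G e = v" "head G e = a" by (rule reachableE)
      obtain f where f: "f \<in> arcs G" "tail G f = b" "head G f = v" using av(2) by (rule reachableE)
      have "awalk b [f] v" using f adj_in_verts[OF av(2)] by (simp add: awalk_simps)
      then have wf: "awalk a (p @ [f]) v" using walk by auto
      have "awalk v (e # p @ [f]) v" using wf e by (simp add: awalk_Cons_iff del: awalk_append_iff)
      moreover have "awalk_verts a (p @ [f]) = awalk_verts a p @ [v]"
        using awalk_verts_append[OF wf] f(3) by simp
      \<comment> \<open>After the initial \<open>v\<close> come the path, which stays in
        \<open>X\<close>, and \<open>v\<close> itself, which is outside \<open>X\<close>.\<close>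
      then have "distinct (tl (awalk_verts v (e # p @ [f])))"
        using dist pX v e(3) by auto
      ultimately have "cycle (e # p @ [f])" unfolding cycle_def by blast
      then have "length (e # p @ [f]) < 3" by (rule no_cycle)
      \<comment> \<open>The arcs \<open>e\<close> and \<open>f\<close> already make two, so fewer
        than three leave none for \<open>p\<close>, and \<open>a\<close> would equal
        \<open>b\<close>.\<close>
      then have "p = []" by simp
      then show False using walk ne by (simp add: awalk_simps)
    qed
  qed
qed


theorem theorem4p6:
  fixes G :: "('a, 'b) pre_digraph" and n r :: nat
  assumes "forest_graph G"
    and "n = card (verts G)"
    and "0 < r"
    and "int n - 5 \<le> int r"
  shows "shellable (Ind r G)"
proof -
  interpret graph G using assms(1) unfolding forest_graph_def by blast
  interpret F: forest_adj "dominates G" using assms(1) by (rule forest_adj_if_forest_graph)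
  have "Ind r G = F.Cx r {} (verts G)"
    unfolding Ind_def F.Cx_def F.indep_def r_independent_iff_linked[OF finite_verts] by simp
  moreover have "comb_shellable (F.Cx r {} (verts G))"
  \<comment> \<open>The link is a smaller complex of the same kind for \<open>r = 1\<close>; for
    \<open>r \<ge> 2\<close> it is controlled by \<open>card (verts G) \<le> r + 5\<close>.\<close>
  proof (cases "r = 1")
    case True
    then show ?thesis using F.comb_shellable_Cx_1 finite_verts by blast
  next
    case False
    then show ?thesis using assms(2-4) by (intro F.comb_shellable_Cx) auto
  qed
  ultimately show ?thesis using shellable_if_comb_shellable by metis
qed

end
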